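(* (a) Let $A$ be a commutative monoid object in $(\mathbf C,\otimes,1)$ and let $\mathscr I=(t)$ be the principal ideal in $\mathcal E(A)$ generated by a given $t\in\mathcal E(A)$. Then $A/tA\cong A/\mathscr I$. (b) Let $A$ be a commutative monoid object in $(\mathbf C,\otimes,1)$ and let $\mathscr I\subseteq\mathcal E(A)$ be an ideal. Then the canonical morphism $A\longrightarrow A/\mathscr I$ is an epimorphism of monoids, i.e., for any commutative monoid $B$ in $\mathbf C$, the induced morphism $Hom_{Comm(\mathbf C)}(A/\mathscr I,B)\longrightarrow Hom_{Comm(\mathbf C)}(A,B)$ is an injection.
   Context: Standing assumptions: $(\mathbf C,\otimes,1)$ is an abelian symmetric monoidal category with small limits and small colimits such that for every object $X$ the functor $-\otimes X$ preserves colimits. $Comm(\mathbf C)$ is the category of unital commutative monoid objects in $\mathbf C$ (all monoids are unital and commutative), and $A\text{-}Mod$ is the category of modules over $A\in Comm(\mathbf C)$. For every monoid $A$, filtered colimits commute with finite limits in $A\text{-}Mod$. Moreover: (C1) $Hom_{\mathbf C}(1,-)$ preserves filtered colimits, and for every monoid $A$ and every finite (not necessarily filtered) system of $A$-modules of the form $\{A^{r_i}\}_{i\in I}$, $r_i\ge 0$, the canonical map $colim_{i}\,Hom_{A-Mod}(A,A^{r_i})\to Hom_{A-Mod}(A,colim_i A^{r_i})$ is an isomorphism. (C2) For every monoid $A$, every object of $A\text{-}Mod$ is a directed colimit of finitely presented objects, where $M$ is finitely presented if $Hom_{A-Mod}(M,-)$ preserves directed colimits. $\mathcal E(A):=Hom_{A-Mod}(A,A)$,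 a commutative ring under composition. Quotients: for $t\in\mathcal E(A)$, $A/tA:=colim(A\overset{t}{\leftarrow}A\to 0)$ (colimit in $A\text{-}Mod$, i.e. the cokernel of $t$), which is a commutative monoid such that the canonical morphism $A\to A/tA$ is a morphism of monoids. For an ideal $\mathscr I\subseteq\mathcal E(A)$, $A/\mathscr I:=colim\{A\to A/tA\}_{t\in\mathscr I}$, the colimit taken in $Comm(\mathbf C)$ of the diagram consisting of all the canonical morphisms $A\to A/tA$, $t\in\mathscr I$, out of the single object $A$. *)

theory Defs
  imports "HOL-Algebra.Ideal" "HOL-Algebra.Product_Groups" "HOL-Library.Equipollence"
begin

section \<open>Categories, functors, limits and colimits\<close>

text \<open>
  Hom-sets are a family indexed by pairs of objects and are not required to be pairwise disjoint,
  so that module and monoid morphisms are literally morphisms of the ambient category.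
  Only \<open>Hom C X Y\<close> with \<open>X, Y\<close> in \<open>Obj C\<close> is meaningful.
\<close>

record ('o, 'm) cat =
  Obj :: "'o set"
  Hom :: "'o \<Rightarrow> 'o \<Rightarrow> 'm set"
  Idm :: "'o \<Rightarrow> 'm"
  Cmp :: "'m \<Rightarrow> 'm \<Rightarrow> 'm" (infixr \<open>\<bullet>\<index>\<close> 70)

locale category =
  fixes C :: "('o, 'm, 'z) cat_scheme" (structure)
  assumes id_in: "X \<in> Obj C \<Longrightarrow> Idm C X \<in> Hom C X X"
    and comp_in: "\<lbrakk>X \<in> Obj C; Y \<in> Obj C; Z \<in> Obj C; f \<in> Hom C X Y; g \<in> Hom C Y Z\<rbrakk>
      \<Longrightarrow> g \<bullet> f \<in> Hom C X Z"
    and comp_id: "\<lbrakk>X \<in> Obj C; Y \<in> Obj C; f \<in> Hom C X Y\<rbrakk> \<Longrightarrow> f \<bullet> Idm C X = f"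
    and id_comp: "\<lbrakk>X \<in> Obj C; Y \<in> Obj C; f \<in> Hom C X Y\<rbrakk> \<Longrightarrow> Idm C Y \<bullet> f = f"
    and comp_assoc: "\<lbrakk>W \<in> Obj C; X \<in> Obj C; Y \<in> Obj C; Z \<in> Obj C;
        f \<in> Hom C W X; g \<in> Hom C X Y; h \<in> Hom C Y Z\<rbrakk>
      \<Longrightarrow> (h \<bullet> g) \<bullet> f = h \<bullet> (g \<bullet> f)"

definition Arr :: "('o, 'm, 'z) cat_scheme \<Rightarrow> 'm set" where
  "Arr C = (\<Union>X\<in>Obj C. \<Union>Y\<in>Obj C. Hom C X Y)"

definition is_isomorphism :: "('o, 'm, 'z) cat_scheme \<Rightarrow> 'o \<Rightarrow> 'o \<Rightarrow> 'm \<Rightarrow> bool" where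
  "is_isomorphism C X Y f \<longleftrightarrow> f \<in> Hom C X Y \<and>
     (\<exists>g\<in>Hom C Y X. g \<bullet>\<^bsub>C\<^esub> f = Idm C X \<and> f \<bullet>\<^bsub>C\<^esub> g = Idm C Y)"

definition isomorphic :: "('o, 'm, 'z) cat_scheme \<Rightarrow> 'o \<Rightarrow> 'o \<Rightarrow> bool" where
  "isomorphic C X Y \<longleftrightarrow> (\<exists>f. is_isomorphism C X Y f)"

definition is_mono :: "('o, 'm, 'z) cat_scheme \<Rightarrow> 'o \<Rightarrow> 'o \<Rightarrow> 'm \<Rightarrow> bool" where
  "is_mono C X Y f \<longleftrightarrow> f \<in> Hom C X Y \<and> (\<forall>Z\<in>Obj C. inj_on (\<lambda>g. f \<bullet>\<^bsub>C\<^esub> g) (Hom C Z X))"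

definition is_epi :: "('o, 'm, 'z) cat_scheme \<Rightarrow> 'o \<Rightarrow> 'o \<Rightarrow> 'm \<Rightarrow> bool" where
  "is_epi C X Y f \<longleftrightarrow> f \<in> Hom C X Y \<and> (\<forall>Z\<in>Obj C. inj_on (\<lambda>g. g \<bullet>\<^bsub>C\<^esub> f) (Hom C Y Z))"

definition is_functor ::
  "('i, 'j, 'y) cat_scheme \<Rightarrow> ('o, 'm, 'z) cat_scheme \<Rightarrow> ('i \<Rightarrow> 'o) \<Rightarrow> ('j \<Rightarrow> 'm) \<Rightarrow> bool" where
  "is_functor J C Fo Fm \<longleftrightarrow>
     (\<forall>i\<in>Obj J. Fo i \<in> Obj C \<and> Fm (Idm J i) = Idm C (Fo i)) \<and>
     (\<forall>i\<in>Obj J. \<forall>j\<in>Obj J. \<forall>u\<in>Hom J i j. Fm u \<in> Hom C (Fo i) (Fo j)) \<and>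
     (\<forall>i\<in>Obj J. \<forall>j\<in>Obj J. \<forall>k\<in>Obj J. \<forall>u\<in>Hom J i j. \<forall>v\<in>Hom J j k.
        Fm (v \<bullet>\<^bsub>J\<^esub> u) = Fm v \<bullet>\<^bsub>C\<^esub> Fm u)"

definition is_cocone ::
  "('i, 'j, 'y) cat_scheme \<Rightarrow> ('o, 'm, 'z) cat_scheme \<Rightarrow> ('i \<Rightarrow> 'o) \<Rightarrow> ('j \<Rightarrow> 'm)
    \<Rightarrow> 'o \<Rightarrow> ('i \<Rightarrow> 'm) \<Rightarrow> bool" where
  "is_cocone J C Fo Fm L c \<longleftrightarrow> L \<in> Obj C \<and> (\<forall>i\<in>Obj J. c i \<in> Hom C (Fo i) L) \<and>
     (\<forall>i\<in>Obj J. \<forall>j\<in>Obj J. \<forall>u\<in>Hom J i j. c j \<bullet>\<^bsub>C\<^esub> Fm u = c i)"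

definition is_colimit ::
  "('i, 'j, 'y) cat_scheme \<Rightarrow> ('o, 'm, 'z) cat_scheme \<Rightarrow> ('i \<Rightarrow> 'o) \<Rightarrow> ('j \<Rightarrow> 'm)
    \<Rightarrow> 'o \<Rightarrow> ('i \<Rightarrow> 'm) \<Rightarrow> bool" where
  "is_colimit J C Fo Fm L c \<longleftrightarrow> is_cocone J C Fo Fm L c \<and>
     (\<forall>L' c'. is_cocone J C Fo Fm L' c' \<longrightarrow>
        (\<exists>!h. h \<in> Hom C L L' \<and> (\<forall>i\<in>Obj J. h \<bullet>\<^bsub>C\<^esub> c i = c' i)))"

definition is_cone ::
  "('i, 'j, 'y) cat_scheme \<Rightarrow> ('o, 'm, 'z) cat_scheme \<Rightarrow> ('i \<Rightarrow> 'o) \<Rightarrow> ('j \<Rightarrow> 'm)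
    \<Rightarrow> 'o \<Rightarrow> ('i \<Rightarrow> 'm) \<Rightarrow> bool" where
  "is_cone J C Fo Fm L c \<longleftrightarrow> L \<in> Obj C \<and> (\<forall>i\<in>Obj J. c i \<in> Hom C L (Fo i)) \<and>
     (\<forall>i\<in>Obj J. \<forall>j\<in>Obj J. \<forall>u\<in>Hom J i j. Fm u \<bullet>\<^bsub>C\<^esub> c i = c j)"

definition is_limit ::
  "('i, 'j, 'y) cat_scheme \<Rightarrow> ('o, 'm, 'z) cat_scheme \<Rightarrow> ('i \<Rightarrow> 'o) \<Rightarrow> ('j \<Rightarrow> 'm)
    \<Rightarrow> 'o \<Rightarrow> ('i \<Rightarrow> 'm) \<Rightarrow> bool" where
  "is_limit J C Fo Fm L c \<longleftrightarrow> is_cone J C Fo Fm L c \<and>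
     (\<forall>L' c'. is_cone J C Fo Fm L' c' \<longrightarrow>
        (\<exists>!h. h \<in> Hom C L' L \<and> (\<forall>i\<in>Obj J. c i \<bullet>\<^bsub>C\<^esub> h = c' i)))"


subsection \<open>Index categories\<close>

text \<open>
  The type \<open>'u\<close> plays the role of the universe: a set is small if its cardinality is strictly less
  than that of \<open>'u\<close> (for a Grothendieck universe of cardinality \<open>\<kappa>\<close> the small sets are, up to
  bijection, those of cardinality less than \<open>\<kappa>\<close>). As \<open>'u\<close> will be infinite, every small
  category is isomorphic to one whose objects and arrows are elements of \<open>'u\<close>.
\<close>

definition small :: "'u itself \<Rightarrow> 'a set \<Rightarrow> bool" where
  "small U S \<longleftrightarrow> S \<prec> (UNIV :: 'u set)"

definition small_category :: "'u itself \<Rightarrow> ('i, 'j, 'y) cat_scheme \<Rightarrow> bool" where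
  "small_category U J \<longleftrightarrow> category J \<and> small U (Obj J) \<and> small U (Arr J)"

definition finite_category :: "('i, 'j, 'y) cat_scheme \<Rightarrow> bool" where
  "finite_category J \<longleftrightarrow> category J \<and> finite (Obj J) \<and> finite (Arr J)"

definition filtered_category :: "('i, 'j, 'y) cat_scheme \<Rightarrow> bool" where
  "filtered_category J \<longleftrightarrow> category J \<and> Obj J \<noteq> {} \<and>
     (\<forall>i\<in>Obj J. \<forall>j\<in>Obj J. \<exists>k\<in>Obj J. Hom J i k \<noteq> {} \<and> Hom J j k \<noteq> {}) \<and>
     (\<forall>i\<in>Obj J. \<forall>j\<in>Obj J. \<forall>u\<in>Hom J i j. \<forall>v\<in>Hom J i j.
        \<exists>k\<in>Obj J. \<exists>w\<in>Hom J j k. w \<bullet>\<^bsub>J\<^esub> u = w \<bullet>\<^bsub>J\<^esub> v)"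

definition discrete_cat :: "'i set \<Rightarrow> ('i, 'i) cat" where
  "discrete_cat S = \<lparr>Obj = S, Hom = (\<lambda>i j. {k. k = i \<and> i = j}), Idm = (\<lambda>i. i),
     Cmp = (\<lambda>j i. i)\<rparr>"

definition poset_cat :: "'i set \<Rightarrow> ('i \<Rightarrow> 'i \<Rightarrow> bool) \<Rightarrow> ('i, 'i \<times> 'i) cat" where
  "poset_cat P rel = \<lparr>Obj = P, Hom = (\<lambda>i j. {u. u = (i, j) \<and> rel i j}), Idm = (\<lambda>i. (i, i)),
     Cmp = (\<lambda>v u. (fst u, snd v))\<rparr>"

definition directed_poset :: "'i set \<Rightarrow> ('i \<Rightarrow> 'i \<Rightarrow> bool) \<Rightarrow> bool" where
  "directed_poset P rel \<longleftrightarrow> P \<noteq> {} \<and> (\<forall>i\<in>P. rel i i) \<and>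
     (\<forall>i\<in>P. \<forall>j\<in>P. rel i j \<and> rel j i \<longrightarrow> i = j) \<and>
     (\<forall>i\<in>P. \<forall>j\<in>P. \<forall>k\<in>P. rel i j \<and> rel j k \<longrightarrow> rel i k) \<and>
     (\<forall>i\<in>P. \<forall>j\<in>P. \<exists>k\<in>P. rel i k \<and> rel j k)"

definition prod_cat :: "('i, 'j) cat \<Rightarrow> ('k, 'l) cat \<Rightarrow> ('i \<times> 'k, 'j \<times> 'l) cat" where
  "prod_cat I J = \<lparr>Obj = Obj I \<times> Obj J,
     Hom = (\<lambda>x y. Hom I (fst x) (fst y) \<times> Hom J (snd x) (snd y)),
     Idm = (\<lambda>x. (Idm I (fst x), Idm J (snd x))),
     Cmp = (\<lambda>v u. (fst v \<bullet>\<^bsub>I\<^esub> fst u, snd v \<bullet>\<^bsub>J\<^esub> snd u))\<rparr>"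

definition has_small_limits :: "'u itself \<Rightarrow> ('o, 'm, 'z) cat_scheme \<Rightarrow> bool" where
  "has_small_limits U C \<longleftrightarrow> (\<forall>(J :: ('u, 'u) cat) Fo Fm.
     small_category U J \<and> is_functor J C Fo Fm \<longrightarrow> (\<exists>L c. is_limit J C Fo Fm L c))"

definition has_small_colimits :: "'u itself \<Rightarrow> ('o, 'm, 'z) cat_scheme \<Rightarrow> bool" where
  "has_small_colimits U C \<longleftrightarrow> (\<forall>(J :: ('u, 'u) cat) Fo Fm.
     small_category U J \<and> is_functor J C Fo Fm \<longrightarrow> (\<exists>L c. is_colimit J C Fo Fm L c))"

definition preserves_small_colimits ::
  "'u itself \<Rightarrow> ('o, 'm, 'z) cat_scheme \<Rightarrow> ('p, 'q, 'y) cat_scheme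
    \<Rightarrow> ('o \<Rightarrow> 'p) \<Rightarrow> ('m \<Rightarrow> 'q) \<Rightarrow> bool" where
  "preserves_small_colimits U C D Go Gm \<longleftrightarrow> (\<forall>(J :: ('u, 'u) cat) Fo Fm L c.
     small_category U J \<and> is_functor J C Fo Fm \<and> is_colimit J C Fo Fm L c \<longrightarrow>
     is_colimit J D (\<lambda>i. Go (Fo i)) (\<lambda>u. Gm (Fm u)) (Go L) (\<lambda>i. Gm (c i)))"

text \<open>
  In \<open>filtered_colimits_commute_with_finite_limits\<close>, \<open>(Lo, Lm)\<close> is the functor
  \<open>j \<mapsto> lim\<^sub>i F(i,j)\<close> with projections \<open>p\<close>, \<open>(Ko, Km)\<close> is the functor \<open>i \<mapsto> colim\<^sub>j F(i,j)\<close> with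
  coprojections \<open>c\<close>, and \<open>h\<close> is the canonical map \<open>colim\<^sub>j lim\<^sub>i F(i,j) \<rightarrow> lim\<^sub>i colim\<^sub>j F(i,j)\<close>,
  which is determined by the equations imposed on it.
\<close>

definition filtered_colimits_commute_with_finite_limits ::
  "'u itself \<Rightarrow> ('o, 'm, 'z) cat_scheme \<Rightarrow> bool" where
  "filtered_colimits_commute_with_finite_limits U C \<longleftrightarrow>
     (\<forall>(I :: ('u, 'u) cat) (J :: ('u, 'u) cat) Fo Fm Lo Lm p Ko Km c Q d P q.
        finite_category I \<and> small_category U J \<and> filtered_category J \<and>
        is_functor (prod_cat I J) C Fo Fm \<and>
        (\<forall>j\<in>Obj J. is_limit I C (\<lambda>i. Fo (i, j)) (\<lambda>u. Fm (u, Idm J j)) (Lo j) (p j)) \<and>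
        is_functor J C Lo Lm \<and>
        (\<forall>j\<in>Obj J. \<forall>j'\<in>Obj J. \<forall>v\<in>Hom J j j'. \<forall>i\<in>Obj I.
           p j' i \<bullet>\<^bsub>C\<^esub> Lm v = Fm (Idm I i, v) \<bullet>\<^bsub>C\<^esub> p j i) \<and>
        (\<forall>i\<in>Obj I. is_colimit J C (\<lambda>j. Fo (i, j)) (\<lambda>v. Fm (Idm I i, v)) (Ko i) (c i)) \<and>
        is_functor I C Ko Km \<and>
        (\<forall>i\<in>Obj I. \<forall>i'\<in>Obj I. \<forall>u\<in>Hom I i i'. \<forall>j\<in>Obj J.
           Km u \<bullet>\<^bsub>C\<^esub> c i j = c i' j \<bullet>\<^bsub>C\<^esub> Fm (u, Idm J j)) \<and>
        is_colimit J C Lo Lm Q d \<and> is_limit I C Ko Km P q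
        \<longrightarrow> (\<exists>h. is_isomorphism C Q P h \<and>
               (\<forall>i\<in>Obj I. \<forall>j\<in>Obj J. q i \<bullet>\<^bsub>C\<^esub> (h \<bullet>\<^bsub>C\<^esub> d j) = c i j \<bullet>\<^bsub>C\<^esub> p j i)))"


subsection \<open>Hom functors and colimits\<close>

text \<open>
  The colimit in the category of sets of a diagram \<open>i \<mapsto> S i\<close>: the disjoint union modulo the
  equivalence relation generated by \<open>(i, x) \<sim> (j, Sm u x)\<close> for \<open>u : i \<rightarrow> j\<close>.
\<close>

definition set_colim :: "('i, 'j, 'y) cat_scheme \<Rightarrow> ('i \<Rightarrow> 'a set) \<Rightarrow> ('j \<Rightarrow> 'a \<Rightarrow> 'a)
    \<Rightarrow> ('i \<times> 'a) set set" where
  "set_colim J S Sm = (SIGMA i:Obj J. S i) //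
     (let R = {((i, x), (j, Sm u x)) | i j u x. i \<in> Obj J \<and> j \<in> Obj J \<and> u \<in> Hom J i j \<and> x \<in> S i}
      in (R \<union> R\<inverse>)\<^sup>*)"

text \<open>The canonical map \<open>colim\<^sub>i Hom(X, F i) \<rightarrow> Hom(X, L)\<close> of sets is bijective.\<close>

definition hom_preserves_colimit ::
  "('o, 'm, 'z) cat_scheme \<Rightarrow> 'o \<Rightarrow> ('i, 'j, 'y) cat_scheme \<Rightarrow> ('i \<Rightarrow> 'o) \<Rightarrow> ('j \<Rightarrow> 'm)
    \<Rightarrow> 'o \<Rightarrow> ('i \<Rightarrow> 'm) \<Rightarrow> bool" where
  "hom_preserves_colimit C X J Fo Fm L c \<longleftrightarrow>
     bij_betw (\<lambda>E. the_elem ((\<lambda>(i, x). c i \<bullet>\<^bsub>C\<^esub> x) ` E))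
       (set_colim J (\<lambda>i. Hom C X (Fo i)) (\<lambda>u x. Fm u \<bullet>\<^bsub>C\<^esub> x)) (Hom C X L)"

definition hom_preserves_filtered_colimits ::
  "'u itself \<Rightarrow> ('o, 'm, 'z) cat_scheme \<Rightarrow> 'o \<Rightarrow> bool" where
  "hom_preserves_filtered_colimits U C X \<longleftrightarrow> (\<forall>(J :: ('u, 'u) cat) Fo Fm L c.
     small_category U J \<and> filtered_category J \<and> is_functor J C Fo Fm \<and> is_colimit J C Fo Fm L c
     \<longrightarrow> hom_preserves_colimit C X J Fo Fm L c)"

definition finitely_presented :: "'u itself \<Rightarrow> ('o, 'm, 'z) cat_scheme \<Rightarrow> 'o \<Rightarrow> bool" where
  "finitely_presented U C X \<longleftrightarrow> X \<in> Obj C \<and> (\<forall>(P :: 'u set) rel Fo Fm L c.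
     small U P \<and> directed_poset P rel \<and> is_functor (poset_cat P rel) C Fo Fm \<and>
     is_colimit (poset_cat P rel) C Fo Fm L c
     \<longrightarrow> hom_preserves_colimit C X (poset_cat P rel) Fo Fm L c)"

definition directed_colimit_of_finitely_presented ::
  "'u itself \<Rightarrow> ('o, 'm, 'z) cat_scheme \<Rightarrow> 'o \<Rightarrow> bool" where
  "directed_colimit_of_finitely_presented U C X \<longleftrightarrow> (\<exists>(P :: 'u set) rel Fo Fm c.
     small U P \<and> directed_poset P rel \<and> is_functor (poset_cat P rel) C Fo Fm \<and>
     (\<forall>i\<in>P. finitely_presented U C (Fo i)) \<and> is_colimit (poset_cat P rel) C Fo Fm X c)"


section \<open>Abelian categories\<close>

record ('o, 'm) ab_cat = "('o, 'm) cat" +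
  hadd :: "'m \<Rightarrow> 'm \<Rightarrow> 'm" (infixl \<open>\<boxplus>\<index>\<close> 65)
  hzero :: "'o \<Rightarrow> 'o \<Rightarrow> 'm"

text \<open>The additive group of morphisms, as a group in the sense of HOL-Algebra.\<close>

definition hom_group :: "('o, 'm, 'z) ab_cat_scheme \<Rightarrow> 'o \<Rightarrow> 'o \<Rightarrow> 'm monoid" where
  "hom_group C X Y = \<lparr>carrier = Hom C X Y, mult = hadd C, one = hzero C X Y\<rparr>"

definition is_kernel :: "('o, 'm, 'z) ab_cat_scheme \<Rightarrow> 'o \<Rightarrow> 'o \<Rightarrow> 'm \<Rightarrow> 'o \<Rightarrow> 'm \<Rightarrow> bool" where
  "is_kernel C X Y f K k \<longleftrightarrow> K \<in> Obj C \<and> k \<in> Hom C K X \<and> f \<bullet>\<^bsub>C\<^esub> k = hzero C K Y \<and>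
     (\<forall>Z\<in>Obj C. \<forall>g\<in>Hom C Z X. f \<bullet>\<^bsub>C\<^esub> g = hzero C Z Y \<longrightarrow>
        (\<exists>!h. h \<in> Hom C Z K \<and> k \<bullet>\<^bsub>C\<^esub> h = g))"

definition is_cokernel :: "('o, 'm, 'z) ab_cat_scheme \<Rightarrow> 'o \<Rightarrow> 'o \<Rightarrow> 'm \<Rightarrow> 'o \<Rightarrow> 'm \<Rightarrow> bool" where
  "is_cokernel C X Y f K k \<longleftrightarrow> K \<in> Obj C \<and> k \<in> Hom C Y K \<and> k \<bullet>\<^bsub>C\<^esub> f = hzero C X K \<and>
     (\<forall>Z\<in>Obj C. \<forall>g\<in>Hom C Y Z. g \<bullet>\<^bsub>C\<^esub> f = hzero C X Z \<longrightarrow>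
        (\<exists>!h. h \<in> Hom C K Z \<and> h \<bullet>\<^bsub>C\<^esub> k = g))"

locale abelian_category = category C for C :: "('o, 'm, 'z) ab_cat_scheme" (structure) +
  assumes hom_group: "\<lbrakk>X \<in> Obj C; Y \<in> Obj C\<rbrakk> \<Longrightarrow> comm_group (hom_group C X Y)"
    and comp_add: "\<lbrakk>X \<in> Obj C; Y \<in> Obj C; Z \<in> Obj C; f \<in> Hom C X Y; f' \<in> Hom C X Y; g \<in> Hom C Y Z\<rbrakk>
      \<Longrightarrow> g \<bullet> (f \<boxplus> f') = (g \<bullet> f) \<boxplus> (g \<bullet> f')"
    and add_comp: "\<lbrakk>X \<in> Obj C; Y \<in> Obj C; Z \<in> Obj C; f \<in> Hom C X Y; g \<in> Hom C Y Z; g' \<in> Hom C Y Z\<rbrakk>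
      \<Longrightarrow> (g \<boxplus> g') \<bullet> f = (g \<bullet> f) \<boxplus> (g' \<bullet> f)"
    and zero_object: "\<exists>Z\<in>Obj C. \<forall>X\<in>Obj C. (\<exists>!f. f \<in> Hom C Z X) \<and> (\<exists>!f. f \<in> Hom C X Z)"
    and biproduct: "\<lbrakk>X \<in> Obj C; Y \<in> Obj C\<rbrakk> \<Longrightarrow>
      \<exists>B\<in>Obj C. \<exists>i\<in>Hom C X B. \<exists>j\<in>Hom C Y B. \<exists>p\<in>Hom C B X. \<exists>q\<in>Hom C B Y.
        p \<bullet> i = Idm C X \<and> q \<bullet> j = Idm C Y \<and> q \<bullet> i = hzero C X Y \<and> p \<bullet> j = hzero C Y X \<and>
        (i \<bullet> p) \<boxplus> (j \<bullet> q) = Idm C B"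
    and kernel: "\<lbrakk>X \<in> Obj C; Y \<in> Obj C; f \<in> Hom C X Y\<rbrakk> \<Longrightarrow> \<exists>K k. is_kernel C X Y f K k"
    and cokernel: "\<lbrakk>X \<in> Obj C; Y \<in> Obj C; f \<in> Hom C X Y\<rbrakk> \<Longrightarrow> \<exists>K k. is_cokernel C X Y f K k"
    and mono_normal: "\<lbrakk>X \<in> Obj C; Y \<in> Obj C; is_mono C X Y f\<rbrakk> \<Longrightarrow>
      \<exists>Z\<in>Obj C. \<exists>g\<in>Hom C Y Z. is_kernel C Y Z g X f"
    and epi_normal: "\<lbrakk>X \<in> Obj C; Y \<in> Obj C; is_epi C X Y f\<rbrakk> \<Longrightarrow>
      \<exists>Z\<in>Obj C. \<exists>g\<in>Hom C Z X. is_cokernel C Z X g Y f"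

text \<open>
  The colimit of the abelian groups \<open>Hom(X, F i)\<close> in the category of abelian groups: the direct sum
  modulo the subgroup generated by the elements \<open>\<iota>\<^sub>j (F u \<bullet> x) - \<iota>\<^sub>i x\<close> for \<open>u : i \<rightarrow> j\<close>.
\<close>

definition hom_sum :: "('o, 'm, 'z) ab_cat_scheme \<Rightarrow> 'o \<Rightarrow> 'i set \<Rightarrow> ('i \<Rightarrow> 'o) \<Rightarrow> ('i \<Rightarrow> 'm) monoid" where
  "hom_sum C X S Fo = sum_group S (\<lambda>i. hom_group C X (Fo i))"

definition hom_sum_inj :: "('o, 'm, 'z) ab_cat_scheme \<Rightarrow> 'o \<Rightarrow> 'i set \<Rightarrow> ('i \<Rightarrow> 'o)
    \<Rightarrow> 'i \<Rightarrow> 'm \<Rightarrow> 'i \<Rightarrow> 'm" where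
  "hom_sum_inj C X S Fo i x = (\<lambda>k\<in>S. if k = i then x else hzero C X (Fo k))"

definition hom_colim :: "('o, 'm, 'z) ab_cat_scheme \<Rightarrow> 'o \<Rightarrow> ('i, 'j, 'y) cat_scheme
    \<Rightarrow> ('i \<Rightarrow> 'o) \<Rightarrow> ('j \<Rightarrow> 'm) \<Rightarrow> ('i \<Rightarrow> 'm) set monoid" where
  "hom_colim C X J Fo Fm =
     (let G = hom_sum C X (Obj J) Fo; \<iota> = hom_sum_inj C X (Obj J) Fo
      in G Mod generate G {\<iota> j (Fm u \<bullet>\<^bsub>C\<^esub> x) \<otimes>\<^bsub>G\<^esub> inv\<^bsub>G\<^esub> \<iota> i x | i j u x.
           i \<in> Obj J \<and> j \<in> Obj J \<and> u \<in> Hom J i j \<and> x \<in> Hom C X (Fo i)})"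

text \<open>
  The canonical homomorphism \<open>colim\<^sub>i Hom(X, F i) \<rightarrow> Hom(X, L)\<close> of abelian groups, induced by
  \<open>(x\<^sub>i)\<^sub>i \<mapsto> \<Sum>\<^sub>i c\<^sub>i \<bullet> x\<^sub>i\<close>, is an isomorphism.
\<close>

definition additive_hom_preserves_colimit ::
  "('o, 'm, 'z) ab_cat_scheme \<Rightarrow> 'o \<Rightarrow> ('i, 'j, 'y) cat_scheme \<Rightarrow> ('i \<Rightarrow> 'o) \<Rightarrow> ('j \<Rightarrow> 'm)
    \<Rightarrow> 'o \<Rightarrow> ('i \<Rightarrow> 'm) \<Rightarrow> bool" where
  "additive_hom_preserves_colimit C X J Fo Fm L c \<longleftrightarrow>
     (\<lambda>E. the_elem ((\<lambda>x. \<Otimes>\<^bsub>hom_group C X L\<^esub>i\<in>{i\<in>Obj J. x i \<noteq> hzero C X (Fo i)}. c i \<bullet>\<^bsub>C\<^esub> x i) ` E))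
     \<in> iso (hom_colim C X J Fo Fm) (hom_group C X L)"

text \<open>\<open>M\<close> is a direct sum \<open>X\<^sup>r\<close> of \<open>r\<close> copies of \<open>X\<close> (a zero object for \<open>r = 0\<close>).\<close>

definition is_power :: "('o, 'm, 'z) cat_scheme \<Rightarrow> 'o \<Rightarrow> nat \<Rightarrow> 'o \<Rightarrow> bool" where
  "is_power C X r M \<longleftrightarrow>
     (\<exists>c. is_colimit (discrete_cat {..<r}) C (\<lambda>_. X) (\<lambda>_. Idm C X) M c)"


section \<open>Symmetric monoidal categories, monoids and modules\<close>

record ('o, 'm) monoidal_ab_cat = "('o, 'm) ab_cat" +
  tensor_ob :: "'o \<Rightarrow> 'o \<Rightarrow> 'o" (infixr \<open>\<boxtimes>\<index>\<close> 75)
  tensor_arr :: "'m \<Rightarrow> 'm \<Rightarrow> 'm" (infixr \<open>\<boxdot>\<index>\<close> 75)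
  unit_ob :: "'o"
  associator :: "'o \<Rightarrow> 'o \<Rightarrow> 'o \<Rightarrow> 'm"
  left_unitor :: "'o \<Rightarrow> 'm"
  right_unitor :: "'o \<Rightarrow> 'm"
  braiding :: "'o \<Rightarrow> 'o \<Rightarrow> 'm"

locale symmetric_monoidal_category = category C
  for C :: "('o, 'm, 'z) monoidal_ab_cat_scheme" (structure) +
  assumes unit_ob: "unit_ob C \<in> Obj C"
    and tensor_ob: "\<lbrakk>X \<in> Obj C; Y \<in> Obj C\<rbrakk> \<Longrightarrow> X \<boxtimes> Y \<in> Obj C"
    and tensor_arr: "\<lbrakk>X \<in> Obj C; Y \<in> Obj C; X' \<in> Obj C; Y' \<in> Obj C; f \<in> Hom C X Y; f' \<in> Hom C X' Y'\<rbrakk>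
      \<Longrightarrow> f \<boxdot> f' \<in> Hom C (X \<boxtimes> X') (Y \<boxtimes> Y')"
    and tensor_id: "\<lbrakk>X \<in> Obj C; Y \<in> Obj C\<rbrakk> \<Longrightarrow> Idm C X \<boxdot> Idm C Y = Idm C (X \<boxtimes> Y)"
    and tensor_comp: "\<lbrakk>X \<in> Obj C; Y \<in> Obj C; Z \<in> Obj C; X' \<in> Obj C; Y' \<in> Obj C; Z' \<in> Obj C;
        f \<in> Hom C X Y; g \<in> Hom C Y Z; f' \<in> Hom C X' Y'; g' \<in> Hom C Y' Z'\<rbrakk>
      \<Longrightarrow> (g \<bullet> f) \<boxdot> (g' \<bullet> f') = (g \<boxdot> g') \<bullet> (f \<boxdot> f')"
    and associator_iso: "\<lbrakk>X \<in> Obj C; Y \<in> Obj C; Z \<in> Obj C\<rbrakk>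
      \<Longrightarrow> is_isomorphism C ((X \<boxtimes> Y) \<boxtimes> Z) (X \<boxtimes> (Y \<boxtimes> Z)) (associator C X Y Z)"
    and associator_natural: "\<lbrakk>X \<in> Obj C; Y \<in> Obj C; Z \<in> Obj C; X' \<in> Obj C; Y' \<in> Obj C; Z' \<in> Obj C;
        f \<in> Hom C X X'; g \<in> Hom C Y Y'; h \<in> Hom C Z Z'\<rbrakk>
      \<Longrightarrow> associator C X' Y' Z' \<bullet> ((f \<boxdot> g) \<boxdot> h) = (f \<boxdot> (g \<boxdot> h)) \<bullet> associator C X Y Z"
    and left_unitor_iso: "X \<in> Obj C \<Longrightarrow> is_isomorphism C (unit_ob C \<boxtimes> X) X (left_unitor C X)"
    and left_unitor_natural: "\<lbrakk>X \<in> Obj C; Y \<in> Obj C; f \<in> Hom C X Y\<rbrakk>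
      \<Longrightarrow> left_unitor C Y \<bullet> (Idm C (unit_ob C) \<boxdot> f) = f \<bullet> left_unitor C X"
    and right_unitor_iso: "X \<in> Obj C \<Longrightarrow> is_isomorphism C (X \<boxtimes> unit_ob C) X (right_unitor C X)"
    and right_unitor_natural: "\<lbrakk>X \<in> Obj C; Y \<in> Obj C; f \<in> Hom C X Y\<rbrakk>
      \<Longrightarrow> right_unitor C Y \<bullet> (f \<boxdot> Idm C (unit_ob C)) = f \<bullet> right_unitor C X"
    and braiding_in: "\<lbrakk>X \<in> Obj C; Y \<in> Obj C\<rbrakk> \<Longrightarrow> braiding C X Y \<in> Hom C (X \<boxtimes> Y) (Y \<boxtimes> X)"
    and braiding_natural: "\<lbrakk>X \<in> Obj C; Y \<in> Obj C; X' \<in> Obj C; Y' \<in> Obj C; f \<in> Hom C X X'; g \<in> Hom C Y Y'\<rbrakk>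
      \<Longrightarrow> braiding C X' Y' \<bullet> (f \<boxdot> g) = (g \<boxdot> f) \<bullet> braiding C X Y"
    and symmetry: "\<lbrakk>X \<in> Obj C; Y \<in> Obj C\<rbrakk> \<Longrightarrow> braiding C Y X \<bullet> braiding C X Y = Idm C (X \<boxtimes> Y)"
    and pentagon: "\<lbrakk>W \<in> Obj C; X \<in> Obj C; Y \<in> Obj C; Z \<in> Obj C\<rbrakk>
      \<Longrightarrow> (Idm C W \<boxdot> associator C X Y Z) \<bullet> associator C W (X \<boxtimes> Y) Z \<bullet> (associator C W X Y \<boxdot> Idm C Z)
        = associator C W X (Y \<boxtimes> Z) \<bullet> associator C (W \<boxtimes> X) Y Z"
    and triangle: "\<lbrakk>X \<in> Obj C; Y \<in> Obj C\<rbrakk>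
      \<Longrightarrow> (Idm C X \<boxdot> left_unitor C Y) \<bullet> associator C X (unit_ob C) Y = right_unitor C X \<boxdot> Idm C Y"
    and hexagon: "\<lbrakk>X \<in> Obj C; Y \<in> Obj C; Z \<in> Obj C\<rbrakk>
      \<Longrightarrow> associator C Y Z X \<bullet> braiding C X (Y \<boxtimes> Z) \<bullet> associator C X Y Z
        = (Idm C Y \<boxdot> braiding C X Z) \<bullet> associator C Y X Z \<bullet> (braiding C X Y \<boxdot> Idm C Z)"

record ('o, 'm) mon_ob =
  mon_carrier :: "'o"
  mon_mult :: "'m"
  mon_unit :: "'m"

definition is_comm_monoid :: "('o, 'm, 'z) monoidal_ab_cat_scheme \<Rightarrow> ('o, 'm) mon_ob \<Rightarrow> bool" where
  "is_comm_monoid C A \<longleftrightarrow>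
     (let X = mon_carrier A; \<mu> = mon_mult A; \<eta> = mon_unit A in
       X \<in> Obj C \<and> \<mu> \<in> Hom C (X \<boxtimes>\<^bsub>C\<^esub> X) X \<and> \<eta> \<in> Hom C (unit_ob C) X \<and>
       \<mu> \<bullet>\<^bsub>C\<^esub> (\<mu> \<boxdot>\<^bsub>C\<^esub> Idm C X) = \<mu> \<bullet>\<^bsub>C\<^esub> (Idm C X \<boxdot>\<^bsub>C\<^esub> \<mu>) \<bullet>\<^bsub>C\<^esub> associator C X X X \<and>
       \<mu> \<bullet>\<^bsub>C\<^esub> (\<eta> \<boxdot>\<^bsub>C\<^esub> Idm C X) = left_unitor C X \<and>
       \<mu> \<bullet>\<^bsub>C\<^esub> (Idm C X \<boxdot>\<^bsub>C\<^esub> \<eta>) = right_unitor C X \<and>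
       \<mu> \<bullet>\<^bsub>C\<^esub> braiding C X X = \<mu>)"

definition Comm :: "('o, 'm, 'z) monoidal_ab_cat_scheme \<Rightarrow> (('o, 'm) mon_ob, 'm) cat" where
  "Comm C = \<lparr>Obj = {A. is_comm_monoid C A},
     Hom = (\<lambda>A B. {f \<in> Hom C (mon_carrier A) (mon_carrier B).
       f \<bullet>\<^bsub>C\<^esub> mon_mult A = mon_mult B \<bullet>\<^bsub>C\<^esub> (f \<boxdot>\<^bsub>C\<^esub> f) \<and> f \<bullet>\<^bsub>C\<^esub> mon_unit A = mon_unit B}),
     Idm = (\<lambda>A. Idm C (mon_carrier A)), Cmp = Cmp C\<rparr>"

record ('o, 'm) mod_ob =
  mod_carrier :: "'o"
  mod_act :: "'m"

definition is_module :: "('o, 'm, 'z) monoidal_ab_cat_scheme \<Rightarrow> ('o, 'm) mon_ob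
    \<Rightarrow> ('o, 'm) mod_ob \<Rightarrow> bool" where
  "is_module C A M \<longleftrightarrow>
     (let X = mon_carrier A; Y = mod_carrier M; \<rho> = mod_act M in
       Y \<in> Obj C \<and> \<rho> \<in> Hom C (X \<boxtimes>\<^bsub>C\<^esub> Y) Y \<and>
       \<rho> \<bullet>\<^bsub>C\<^esub> (mon_mult A \<boxdot>\<^bsub>C\<^esub> Idm C Y) = \<rho> \<bullet>\<^bsub>C\<^esub> (Idm C X \<boxdot>\<^bsub>C\<^esub> \<rho>) \<bullet>\<^bsub>C\<^esub> associator C X X Y \<and>
       \<rho> \<bullet>\<^bsub>C\<^esub> (mon_unit A \<boxdot>\<^bsub>C\<^esub> Idm C Y) = left_unitor C Y)"

definition Modules :: "('o, 'm, 'z) monoidal_ab_cat_scheme \<Rightarrow> ('o, 'm) mon_ob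
    \<Rightarrow> (('o, 'm) mod_ob, 'm) ab_cat" where
  "Modules C A = \<lparr>Obj = {M. is_module C A M},
     Hom = (\<lambda>M N. {f \<in> Hom C (mod_carrier M) (mod_carrier N).
       f \<bullet>\<^bsub>C\<^esub> mod_act M = mod_act N \<bullet>\<^bsub>C\<^esub> (Idm C (mon_carrier A) \<boxdot>\<^bsub>C\<^esub> f)}),
     Idm = (\<lambda>M. Idm C (mod_carrier M)), Cmp = Cmp C,
     hadd = hadd C, hzero = (\<lambda>M N. hzero C (mod_carrier M) (mod_carrier N))\<rparr>"

definition regular_module :: "('o, 'm) mon_ob \<Rightarrow> ('o, 'm) mod_ob" where
  "regular_module A = \<lparr>mod_carrier = mon_carrier A, mod_act = mon_mult A\<rparr>"


section \<open>The standing assumptions\<close>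

locale standing_assumptions =
  abelian_category C + symmetric_monoidal_category C
  for C :: "('o, 'm, 'z) monoidal_ab_cat_scheme" (structure) +
  fixes U :: "'u itself"
  assumes infinite_universe: "infinite (UNIV :: 'u set)"
    and locally_small: "\<lbrakk>X \<in> Obj C; Y \<in> Obj C\<rbrakk> \<Longrightarrow> small U (Hom C X Y)"
    and small_limits: "has_small_limits U C"
    and small_colimits: "has_small_colimits U C"
    and tensor_preserves_colimits: "X \<in> Obj C \<Longrightarrow>
      preserves_small_colimits U C C (\<lambda>Y. Y \<boxtimes> X) (\<lambda>f. f \<boxdot> Idm C X)"
    and filtered_colimits_finite_limits: "A \<in> Obj (Comm C) \<Longrightarrow>
      filtered_colimits_commute_with_finite_limits U (Modules C A)"
    and C1_unit: "hom_preserves_filtered_colimits U C (unit_ob C)"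
    and C1_finite: "\<lbrakk>A \<in> Obj (Comm C); finite_category (I :: ('u, 'u) cat);
        is_functor I (Modules C A) Fo Fm;
        \<forall>i\<in>Obj I. \<exists>r. is_power (Modules C A) (regular_module A) r (Fo i);
        is_colimit I (Modules C A) Fo Fm L c\<rbrakk>
      \<Longrightarrow> additive_hom_preserves_colimit (Modules C A) (regular_module A) I Fo Fm L c"
    and C2: "\<lbrakk>A \<in> Obj (Comm C); M \<in> Obj (Modules C A)\<rbrakk> \<Longrightarrow>
      directed_colimit_of_finitely_presented U (Modules C A) M"


section \<open>Endomorphism rings and quotients\<close>

definition End_ring :: "('o, 'm, 'z) monoidal_ab_cat_scheme \<Rightarrow> ('o, 'm) mon_ob \<Rightarrow> 'm ring" where
  "End_ring C A = (let R = regular_module A; D = Modules C A in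
     \<lparr>carrier = Hom D R R, mult = Cmp D, one = Idm D R, zero = hzero D R R, add = hadd D\<rparr>)"

text \<open>
  \<open>Q\<close> with \<open>q\<close> represents \<open>A/tA\<close> with its canonical morphism: the underlying object of the monoid
  \<open>Q\<close> is that of a cokernel \<open>q : A \<rightarrow> N\<close> of \<open>t\<close> in the category of \<open>A\<close>-modules, and \<open>q\<close> is a morphism
  of monoids.
\<close>

definition is_element_quotient :: "('o, 'm, 'z) monoidal_ab_cat_scheme \<Rightarrow> ('o, 'm) mon_ob \<Rightarrow> 'm
    \<Rightarrow> ('o, 'm) mon_ob \<Rightarrow> 'm \<Rightarrow> bool" where
  "is_element_quotient C A t Q q \<longleftrightarrow>
     (\<exists>N. is_cokernel (Modules C A) (regular_module A) (regular_module A) t N q \<and>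
          mon_carrier Q = mod_carrier N) \<and>
     Q \<in> Obj (Comm C) \<and> q \<in> Hom (Comm C) A Q"

text \<open>
  \<open>R\<close> with \<open>p\<close> represents \<open>A/I\<close> with its canonical morphism. The index category of the diagram has
  an initial object \<open>None\<close>, sent to \<open>A\<close>, and an object \<open>Some t\<close> for each \<open>t \<in> I\<close>, sent to \<open>A/tA\<close>.
\<close>

definition is_ideal_quotient :: "('o, 'm, 'z) monoidal_ab_cat_scheme \<Rightarrow> ('o, 'm) mon_ob \<Rightarrow> 'm set
    \<Rightarrow> ('o, 'm) mon_ob \<Rightarrow> 'm \<Rightarrow> bool" where
  "is_ideal_quotient C A I R p \<longleftrightarrow>
     (\<exists>Q q c. (\<forall>t\<in>I. is_element_quotient C A t (Q t) (q t)) \<and>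
        is_colimit (poset_cat (insert None (Some ` I)) (\<lambda>x y. x = None \<or> x = y)) (Comm C)
          (\<lambda>x. case x of None \<Rightarrow> A | Some t \<Rightarrow> Q t)
          (\<lambda>u. case u of (None, Some t) \<Rightarrow> q t
               | (None, None) \<Rightarrow> Idm (Comm C) A
               | (Some t, _) \<Rightarrow> Idm (Comm C) (Q t))
          R c \<and>
        p = c None)"

end

theory Submission
  imports Defs
begin

text \<open>A module cokernel of \<open>t\<close> is a cokernel in the ambient category, so \<open>A \<rightarrow> A/tA\<close> is an
  epimorphism there and has the universal property of killing \<open>t\<close> among monoid morphisms. A morphism
  out of \<open>A/I\<close> is determined by its restrictions to the \<open>A/tA\<close>, hence by its restriction to \<open>A\<close>. For
  \<open>I = (t)\<close>, commutativity of \<open>End(A)\<close> shows that every element of \<open>I\<close> is killed by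
  \<open>A \<rightarrow> A/tA\<close>, so \<open>A/tA\<close> and \<open>A/I\<close> have the same universal property.\<close>

text \<open>The quotient \<open>A/tA\<close> is given by a universal property among modules, whereas
  multiplicativity of a morphism \<open>h\<close> out of it is an equation on the tensor square of
  the ambient object. That equation can only be tested after \<open>q \<boxdot> q\<close>, so
  cokernels in the ambient category must survive tensoring. The assumptions say only that tensoring
  on one side preserves small colimits; additivity of the tensor product on morphisms is not among
  them. A cokernel is therefore read as the coequalizer of \<open>f\<close> and a zero morphism over
  an index category inside \<open>'u\<close>, preservation of zero morphisms is recovered from the
  empty colimit, and the braiding gives the other side. The same preservation lets the module laws
  descend from \<open>A\<close> to the ambient cokernel, which makes it a legitimate test object for
  the module cokernel. Finally, quotients are fixed only up to isomorphism, so the representative of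
  \<open>A/tA\<close> inside the diagram may differ from a given one, and the two must be related
  through what they kill.\<close>

subsection \<open>Coequalizers as small colimits\<close>

text \<open>The walking parallel pair \<open>u, v : a \<rightarrow> b\<close>; the objects double as identities.\<close>

definition parallel_cat :: "'u \<Rightarrow> 'u \<Rightarrow> 'u \<Rightarrow> 'u \<Rightarrow> ('u, 'u) cat" where
  "parallel_cat a b u v = \<lparr>Obj = {a, b},
     Hom = (\<lambda>i j. if i = j then {i} else if i = a \<and> j = b then {u, v} else {}),
     Idm = (\<lambda>i. i), Cmp = (\<lambda>g f. if g \<in> {a, b} then f else g)\<rparr>"

lemma small_parallel_cat:
  assumes "distinct [a, b, u, v]" "infinite (UNIV :: 'u set)"
  shows "small_category (U :: 'u itself) (parallel_cat a b u v)"
proof -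
  \<comment> \<open>In a composable pair one factor is an identity: a non-identity \<open>g\<close>
    has source \<open>a\<close>, so the arrow before it can only be \<open>a\<close> itself. This is
    why the case distinction in \<open>Cmp\<close> is enough.\<close>
  have "category (parallel_cat a b u v)"
    using assms(1) by unfold_locales (auto simp: parallel_cat_def split: if_splits)
  moreover have "finite (Arr (parallel_cat a b u v))"
    by (auto simp: parallel_cat_def Arr_def)
  moreover have "finite (Obj (parallel_cat a b u v))"
    by (auto simp: parallel_cat_def)
  ultimately show ?thesis
    unfolding small_category_def small_def using finite_lesspoll_infinite[OF assms(2)] by blast
qed

text \<open>Preservation of colimits is assumed for index categories with objects and arrows in
  \<open>'u\<close>. Since objects double as identities, the walking parallel pair needs four
  elements of that type.\<close>

lemma distinct_four_exist:
  assumes "infinite (UNIV :: 'u set)"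
  shows "\<exists>a b u v :: 'u. distinct [a, b, u, v]"
proof -
  obtain S :: "'u set" where S: "card S = 4" "finite S"
    using infinite_arbitrarily_large[OF assms] by blast
  obtain xs where "set xs = S" "distinct xs" "length xs = 4"
    using finite_distinct_list[OF S(2)] S(1) distinct_card by metis
  then obtain a b u v where "xs = [a, b, u, v]"
    by (auto simp: numeral_eq_Suc length_Suc_conv)
  with \<open>distinct xs\<close> show ?thesis by blast
qed

lemma (in category) parallel_functor:
  assumes "distinct [a, b, u, v]" "X \<in> Obj C" "Y \<in> Obj C" "f \<in> Hom C X Y" "g \<in> Hom C X Y"
  shows "is_functor (parallel_cat a b u v) C (\<lambda>i. if i = a then X else Y)
    (\<lambda>w. if w = a then Idm C X else if w = b then Idm C Y else if w = u then f else g)"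
  using assms id_in comp_id id_comp
  by (auto simp: is_functor_def parallel_cat_def split: if_splits)

lemma (in category) parallel_cocone_iff:
  assumes "distinct [a, b, u, v]" "Go a \<in> Obj C" "Go b \<in> Obj C"
    "Gm a = Idm C (Go a)" "Gm b = Idm C (Go b)"
  shows "is_cocone (parallel_cat a b u v) C Go Gm L c \<longleftrightarrow>
    L \<in> Obj C \<and> c a \<in> Hom C (Go a) L \<and> c b \<in> Hom C (Go b) L \<and>
    c b \<bullet> Gm u = c a \<and> c b \<bullet> Gm v = c a"
  using assms comp_id
  by (auto simp: is_cocone_def parallel_cat_def split: if_splits)

lemma (in category) isomorphism_inverse:
  assumes "is_isomorphism C X Y f"
  obtains g where "f \<in> Hom C X Y" "g \<in> Hom C Y X" "g \<bullet> f = Idm C X" "f \<bullet> g = Idm C Y"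
  using assms unfolding is_isomorphism_def by blast


subsection \<open>Cokernels in an abelian category\<close>

context abelian_category
begin

lemma zero_in: "X \<in> Obj C \<Longrightarrow> Y \<in> Obj C \<Longrightarrow> hzero C X Y \<in> Hom C X Y"
  using hom_group[of X Y] monoid.one_closed[of "hom_group C X Y"]
  by (simp add: hom_group_def comm_group_def group_def)

text \<open>Cancellation in the hom group. It turns the distributive laws into the absorption laws:
  \<open>g \<bullet> 0 = g \<bullet> (0 + 0) = g \<bullet> 0 + g \<bullet> 0\<close>.\<close>

lemma idempotent_zero:
  assumes "X \<in> Obj C" "Y \<in> Obj C" "f \<in> Hom C X Y" "f \<boxplus> f = f"
  shows "f = hzero C X Y"
proof -
  interpret G: comm_group "hom_group C X Y" using hom_group assms by blast
  show ?thesis using G.r_cancel_one[of f f] assms by (simp add: hom_group_def)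
qed

lemma add_zero_zero:
  assumes "X \<in> Obj C" "Y \<in> Obj C"
  shows "hzero C X Y \<boxplus> hzero C X Y = hzero C X Y"
proof -
  interpret G: comm_group "hom_group C X Y" using hom_group assms by blast
  show ?thesis using G.l_one[of "hzero C X Y"] zero_in assms by (simp add: hom_group_def)
qed

lemma comp_zero:
  assumes "X \<in> Obj C" "Y \<in> Obj C" "Z \<in> Obj C" "g \<in> Hom C Y Z"
  shows "g \<bullet> hzero C X Y = hzero C X Z"
  using comp_add[OF assms(1-3) zero_in zero_in assms(4)] assms comp_in[OF assms(1-3) zero_in assms(4)]
  by (intro idempotent_zero) (auto simp: add_zero_zero)

lemma zero_comp:
  assumes "X \<in> Obj C" "Y \<in> Obj C" "Z \<in> Obj C" "f \<in> Hom C X Y"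
  shows "hzero C Y Z \<bullet> f = hzero C X Z"
  using add_comp[OF assms zero_in zero_in] assms comp_in[OF assms zero_in]
  by (intro idempotent_zero) (auto simp: add_zero_zero)

text \<open>A cokernel morphism is epi because \<open>g \<bullet> k\<close> kills \<open>f\<close>,
  so the uniqueness clause applies to it. Applied to tensored cokernels, this is how the equations
  between structure morphisms are proved below.\<close>

lemma cokernel_cancel:
  assumes "is_cokernel C X Y f K k" "X \<in> Obj C" "Y \<in> Obj C" "f \<in> Hom C X Y" "Z \<in> Obj C"
    and g: "g \<in> Hom C K Z" and h: "h \<in> Hom C K Z" and eq: "g \<bullet> k = h \<bullet> k"
  shows "g = h"
proof -
  have K: "K \<in> Obj C" "k \<in> Hom C Y K" "k \<bullet> f = hzero C X K"
    using assms(1) by (auto simp: is_cokernel_def)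
  have "(g \<bullet> k) \<bullet> f = g \<bullet> (k \<bullet> f)"
    using assms K comp_assoc by blast
  also have "\<dots> = hzero C X Z" using assms K comp_zero by auto
  finally have "(g \<bullet> k) \<bullet> f = hzero C X Z" .
  moreover have "g \<bullet> k \<in> Hom C Y Z" using assms K comp_in by blast
  ultimately have "\<exists>!x. x \<in> Hom C K Z \<and> x \<bullet> k = g \<bullet> k"
    using assms(1,5) by (auto simp: is_cokernel_def)
  then show ?thesis using g h eq by auto
qed

lemma cokernel_factor:
  assumes "is_cokernel C X Y f K k" "Z \<in> Obj C" "g \<in> Hom C Y Z" "g \<bullet> f = hzero C X Z"
  obtains h where "h \<in> Hom C K Z" "h \<bullet> k = g"
  using assms unfolding is_cokernel_def by blast

text \<open>Puts cokernels into the form to which the preservation assumption applies: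
  \<open>K\<close> is the coequalizer of \<open>f\<close> and zero.\<close>

lemma cokernel_parallel_colimit:
  assumes "distinct [a, b, u, v]" "X \<in> Obj C" "Y \<in> Obj C" "f \<in> Hom C X Y"
    and cok: "is_cokernel C X Y f K k"
  shows "is_colimit (parallel_cat a b u v) C (\<lambda>i. if i = a then X else Y)
    (\<lambda>w. if w = a then Idm C X else if w = b then Idm C Y else if w = u then f else hzero C X Y)
    K (\<lambda>i. if i = a then hzero C X K else k)"
    (is "is_colimit ?J C ?Fo ?Fm K ?c")
proof -
  have K: "K \<in> Obj C" "k \<in> Hom C Y K" "k \<bullet> f = hzero C X K"
    using cok by (auto simp: is_cokernel_def)
  have ne: "b \<noteq> a" "u \<noteq> a" "u \<noteq> b" "v \<noteq> a" "v \<noteq> b" "v \<noteq> u" using assms(1) by auto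
  have cocone_iff: "is_cocone ?J C ?Fo ?Fm L c \<longleftrightarrow> L \<in> Obj C \<and> c a \<in> Hom C X L \<and>
      c b \<in> Hom C Y L \<and> c b \<bullet> f = c a \<and> c b \<bullet> hzero C X Y = c a" for L c
    using parallel_cocone_iff[OF assms(1), of ?Fo ?Fm L c] assms(2,3) ne by simp
  have "is_cocone ?J C ?Fo ?Fm K ?c"
    using K ne assms comp_zero zero_in unfolding cocone_iff by auto
  moreover have "\<exists>!h. h \<in> Hom C K L \<and> (\<forall>i\<in>Obj ?J. h \<bullet> ?c i = c i)"
    if "is_cocone ?J C ?Fo ?Fm L c" for L c
  proof -
    have L: "L \<in> Obj C" "c b \<in> Hom C Y L" "c b \<bullet> f = c a" "c b \<bullet> hzero C X Y = c a"
      using that cocone_iff by auto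
    \<comment> \<open>The zero arrow of the pair forces the leg at \<open>a\<close> to vanish, so a
      cocone amounts to a morphism out of \<open>Y\<close> that kills \<open>f\<close>.\<close>
    then have ca: "c a = hzero C X L" using comp_zero assms by metis
    have "\<exists>!h. h \<in> Hom C K L \<and> h \<bullet> k = c b"
      using cok L ca by (auto simp: is_cokernel_def)
    moreover have "(\<forall>i\<in>Obj ?J. h \<bullet> ?c i = c i) \<longleftrightarrow> h \<bullet> k = c b" if "h \<in> Hom C K L" for h
      using that ne ca comp_zero[OF assms(2) K(1) L(1)] by (auto simp: parallel_cat_def)
    ultimately show ?thesis by metis
  qed
  ultimately show ?thesis unfolding is_colimit_def by blast
qed

end


subsection \<open>Tensoring cokernels\<close>

context standing_assumptions
begin

text \<open>A zero morphism factors through a zero object \<open>Z\<close>. As an initial object,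
  \<open>Z\<close> is the colimit of the empty diagram, so \<open>Z \<boxtimes> W\<close> is again
  initial. Every morphism out of it is then zero, and with it every composite through it.\<close>

lemma tensor_zero:
  assumes X: "X \<in> Obj C" and Y: "Y \<in> Obj C" and W: "W \<in> Obj C"
  shows "hzero C X Y \<boxdot> Idm C W = hzero C (X \<boxtimes> W) (Y \<boxtimes> W)"
proof -
  obtain Z where Z: "Z \<in> Obj C"
    and "\<forall>T\<in>Obj C. (\<exists>!f. f \<in> Hom C Z T) \<and> (\<exists>!f. f \<in> Hom C T Z)"
    using zero_object by (rule bexE)
  then have init: "\<exists>!f. f \<in> Hom C Z T" if "T \<in> Obj C" for T
    using that by simp
  define J :: "('u, 'u) cat" where "J = discrete_cat {}"
  have small: "small_category U J"
    using finite_lesspoll_infinite[OF infinite_universe finite.emptyI]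
    unfolding small_category_def small_def J_def
    by (simp add: discrete_cat_def Arr_def category_def)
  have "is_functor J C (\<lambda>_. Z) (\<lambda>_. Idm C Z)"
    by (simp add: J_def discrete_cat_def is_functor_def)
  moreover have "is_colimit J C (\<lambda>_. Z) (\<lambda>_. Idm C Z) Z (\<lambda>_. Idm C Z)"
    using Z init by (simp add: J_def discrete_cat_def is_colimit_def is_cocone_def)
  ultimately have "is_colimit J C (\<lambda>_. Z \<boxtimes> W) (\<lambda>_. Idm C Z \<boxdot> Idm C W) (Z \<boxtimes> W) (\<lambda>_. Idm C Z \<boxdot> Idm C W)"
    using tensor_preserves_colimits[OF W] small unfolding preserves_small_colimits_def by blast
  then have ZW: "\<exists>!f. f \<in> Hom C (Z \<boxtimes> W) T" if "T \<in> Obj C" for T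
    using that by (simp add: J_def discrete_cat_def is_colimit_def is_cocone_def)
  note obs = tensor_ob[OF X W] tensor_ob[OF Y W] tensor_ob[OF Z W]
  have "hzero C Z Y \<boxdot> Idm C W \<in> Hom C (Z \<boxtimes> W) (Y \<boxtimes> W)"
    using tensor_arr[OF Z Y W W] zero_in[OF Z Y] id_in[OF W] by blast
  then have z: "hzero C Z Y \<boxdot> Idm C W = hzero C (Z \<boxtimes> W) (Y \<boxtimes> W)"
    using ZW[OF obs(2)] zero_in[OF obs(3,2)] by (auto elim: ex1E)
  have "hzero C X Y \<boxdot> Idm C W = (hzero C Z Y \<bullet> hzero C X Z) \<boxdot> (Idm C W \<bullet> Idm C W)"
    using comp_zero[OF X Z Y zero_in[OF Z Y]] comp_id[OF W W id_in[OF W]] by simp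
  also have "\<dots> = (hzero C Z Y \<boxdot> Idm C W) \<bullet> (hzero C X Z \<boxdot> Idm C W)"
    using tensor_comp[OF X Z Y W W W zero_in[OF X Z] zero_in[OF Z Y] id_in[OF W] id_in[OF W]] .
  also have "\<dots> = hzero C (X \<boxtimes> W) (Y \<boxtimes> W)"
    unfolding z using zero_comp[OF obs(1,3,2) tensor_arr[OF X Z W W zero_in[OF X Z] id_in[OF W]]] .
  finally show ?thesis .
qed

text \<open>Tensoring carries the coequalizer of \<open>f\<close> and zero to the coequalizer of the
  two tensored arrows; \<open>tensor_zero\<close> makes the second of these zero again, so the
  result reads back as a cokernel.\<close>

lemma cokernel_tensor_right:
  assumes X: "X \<in> Obj C" and Y: "Y \<in> Obj C" and W: "W \<in> Obj C" and f: "f \<in> Hom C X Y"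
    and cok: "is_cokernel C X Y f K k"
  shows "is_cokernel C (X \<boxtimes> W) (Y \<boxtimes> W) (f \<boxdot> Idm C W) (K \<boxtimes> W) (k \<boxdot> Idm C W)"
proof -
  have K: "K \<in> Obj C" "k \<in> Hom C Y K" "k \<bullet> f = hzero C X K"
    using cok by (auto simp: is_cokernel_def)
  note obs = tensor_ob[OF X W] tensor_ob[OF Y W] tensor_ob[OF K(1) W]
  have kW: "k \<boxdot> Idm C W \<in> Hom C (Y \<boxtimes> W) (K \<boxtimes> W)"
    using tensor_arr Y K W id_in by blast
  have "(k \<boxdot> Idm C W) \<bullet> (f \<boxdot> Idm C W) = (k \<bullet> f) \<boxdot> (Idm C W \<bullet> Idm C W)"
    using tensor_comp[OF X Y K(1) W W W f K(2)] id_in W by metis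
  then have zero: "(k \<boxdot> Idm C W) \<bullet> (f \<boxdot> Idm C W) = hzero C (X \<boxtimes> W) (K \<boxtimes> W)"
    using K tensor_zero X W id_in comp_id by metis
  obtain a b u v :: 'u where d: "distinct [a, b, u, v]"
    using distinct_four_exist[OF infinite_universe] by blast
  let ?J = "parallel_cat a b u v"
  let ?Fo = "\<lambda>i. if i = a then X else Y"
  let ?Fm = "\<lambda>w. if w = a then Idm C X else if w = b then Idm C Y else if w = u then f else hzero C X Y"
  let ?c = "\<lambda>i. if i = a then hzero C X K else k"
  have ne: "b \<noteq> a" "u \<noteq> a" "u \<noteq> b" "v \<noteq> a" "v \<noteq> b" "v \<noteq> u" using d by auto
  let ?Go = "\<lambda>i. ?Fo i \<boxtimes> W" and ?Gm = "\<lambda>w. ?Fm w \<boxdot> Idm C W" and ?d = "\<lambda>i. ?c i \<boxdot> Idm C W"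
  have col: "is_colimit ?J C ?Go ?Gm (K \<boxtimes> W) ?d"
    using tensor_preserves_colimits[OF W] small_parallel_cat[OF d infinite_universe, of U]
      parallel_functor[OF d X Y f zero_in[OF X Y]] cokernel_parallel_colimit[OF d X Y f cok]
    unfolding preserves_small_colimits_def by blast
  have cocone_iff: "is_cocone ?J C ?Go ?Gm L c \<longleftrightarrow> L \<in> Obj C \<and> c a \<in> Hom C (X \<boxtimes> W) L \<and>
      c b \<in> Hom C (Y \<boxtimes> W) L \<and> c b \<bullet> (f \<boxdot> Idm C W) = c a \<and>
      c b \<bullet> hzero C (X \<boxtimes> W) (Y \<boxtimes> W) = c a" for L c
    using parallel_cocone_iff[OF d, of ?Go ?Gm L c] tensor_zero[OF X Y W] obs ne
      tensor_id[OF X W] tensor_id[OF Y W] by simp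
  have "\<exists>!h. h \<in> Hom C (K \<boxtimes> W) L \<and> h \<bullet> (k \<boxdot> Idm C W) = g"
    if L: "L \<in> Obj C" and g: "g \<in> Hom C (Y \<boxtimes> W) L"
      and g0: "g \<bullet> (f \<boxdot> Idm C W) = hzero C (X \<boxtimes> W) L" for L g
  proof -
    \<comment> \<open>A morphism \<open>g\<close> killing the tensored \<open>f\<close> becomes a
      cocone once it is given the zero leg at \<open>a\<close>.\<close>
    let ?e = "\<lambda>i. if i = a then hzero C (X \<boxtimes> W) L else g"
    have "is_cocone ?J C ?Go ?Gm L ?e"
      unfolding cocone_iff using L g g0 ne obs zero_in comp_zero by auto
    then have "\<exists>!h. h \<in> Hom C (K \<boxtimes> W) L \<and> (\<forall>i\<in>Obj ?J. h \<bullet> ?d i = ?e i)"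
      using col unfolding is_colimit_def by blast
    moreover have "(\<forall>i\<in>Obj ?J. h \<bullet> ?d i = ?e i) \<longleftrightarrow> h \<bullet> (k \<boxdot> Idm C W) = g"
      if "h \<in> Hom C (K \<boxtimes> W) L" for h
      using that ne tensor_zero[OF X K(1) W] comp_zero[OF obs(1) obs(3) L]
      by (auto simp: parallel_cat_def)
    ultimately show ?thesis by metis
  qed
  then show ?thesis using kW zero obs by (auto simp: is_cokernel_def)
qed

text \<open>The braiding transports the right-handed statement to the left.\<close>

lemma cokernel_tensor_left:
  assumes X: "X \<in> Obj C" and Y: "Y \<in> Obj C" and W: "W \<in> Obj C" and f: "f \<in> Hom C X Y"
    and cok: "is_cokernel C X Y f K k"
  shows "is_cokernel C (W \<boxtimes> X) (W \<boxtimes> Y) (Idm C W \<boxdot> f) (W \<boxtimes> K) (Idm C W \<boxdot> k)"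
proof -
  have K: "K \<in> Obj C" "k \<in> Hom C Y K" "k \<bullet> f = hzero C X K"
    using cok by (auto simp: is_cokernel_def)
  have right: "is_cokernel C (X \<boxtimes> W) (Y \<boxtimes> W) (f \<boxdot> Idm C W) (K \<boxtimes> W) (k \<boxdot> Idm C W)"
    using cokernel_tensor_right assms by blast
  note obs = tensor_ob[OF X W] tensor_ob[OF Y W] tensor_ob[OF K(1) W]
     tensor_ob[OF W X] tensor_ob[OF W Y] tensor_ob[OF W K(1)]
  note idW = id_in[OF W]
  have arrs: "f \<boxdot> Idm C W \<in> Hom C (X \<boxtimes> W) (Y \<boxtimes> W)" "k \<boxdot> Idm C W \<in> Hom C (Y \<boxtimes> W) (K \<boxtimes> W)"
    "Idm C W \<boxdot> f \<in> Hom C (W \<boxtimes> X) (W \<boxtimes> Y)" "Idm C W \<boxdot> k \<in> Hom C (W \<boxtimes> Y) (W \<boxtimes> K)"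
    using tensor_arr X Y W K f idW by blast+
  let ?bX = "braiding C X W" and ?bY = "braiding C Y W" and ?bK = "braiding C K W"
  let ?rX = "braiding C W X" and ?rY = "braiding C W Y" and ?rK = "braiding C W K"
  note br = braiding_in[OF X W] braiding_in[OF Y W] braiding_in[OF K(1) W]
     braiding_in[OF W X] braiding_in[OF W Y] braiding_in[OF W K(1)]
  note nat_f = braiding_natural[OF X W Y W f idW] braiding_natural[OF W X W Y idW f]
  note nat_k = braiding_natural[OF Y W K(1) W K(2) idW] braiding_natural[OF W Y W K(1) idW K(2)]
  have zero: "(Idm C W \<boxdot> k) \<bullet> (Idm C W \<boxdot> f) = hzero C (W \<boxtimes> X) (W \<boxtimes> K)"
  proof -
    have "(Idm C W \<boxdot> k) \<bullet> (Idm C W \<boxdot> f) = (Idm C W \<bullet> Idm C W) \<boxdot> (k \<bullet> f)"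
      using tensor_comp[OF W W W X Y K(1) idW idW f K(2)] by simp
    also have "\<dots> = Idm C W \<boxdot> hzero C X K" using comp_id[OF W W idW] K by simp
    \<comment> \<open>Inserting the identity as a double braiding moves the zero morphism into the
      left factor, where \<open>tensor_zero\<close> applies.\<close>
    also have "\<dots> = (Idm C W \<boxdot> hzero C X K) \<bullet> (?bX \<bullet> ?rX)"
      using symmetry[OF W X] comp_id obs tensor_arr[OF W W X K(1) idW zero_in[OF X K(1)]] by metis
    also have "\<dots> = ((Idm C W \<boxdot> hzero C X K) \<bullet> ?bX) \<bullet> ?rX"
      using comp_assoc obs br tensor_arr[OF W W X K(1) idW zero_in[OF X K(1)]] by metis
    also have "\<dots> = (?bK \<bullet> (hzero C X K \<boxdot> Idm C W)) \<bullet> ?rX"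
      using braiding_natural[OF X W K(1) W zero_in[OF X K(1)] idW] by simp
    also have "\<dots> = hzero C (W \<boxtimes> X) (W \<boxtimes> K)"
      using tensor_zero[OF X K(1) W] comp_zero zero_comp obs br by metis
    finally show ?thesis .
  qed
  have "\<exists>!h. h \<in> Hom C (W \<boxtimes> K) L \<and> h \<bullet> (Idm C W \<boxdot> k) = g"
    if L: "L \<in> Obj C" and g: "g \<in> Hom C (W \<boxtimes> Y) L"
      and g0: "g \<bullet> (Idm C W \<boxdot> f) = hzero C (W \<boxtimes> X) L" for L g
  proof -
    have gb: "g \<bullet> ?bY \<in> Hom C (Y \<boxtimes> W) L" using g br obs L comp_in by blast
    have "(g \<bullet> ?bY) \<bullet> (f \<boxdot> Idm C W) = g \<bullet> (?bY \<bullet> (f \<boxdot> Idm C W))"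
      using comp_assoc obs L g br arrs by blast
    also have "\<dots> = (g \<bullet> (Idm C W \<boxdot> f)) \<bullet> ?bX"
      unfolding nat_f using comp_assoc[OF obs(1,4,5) L br(1) arrs(3) g] by simp
    also have "\<dots> = hzero C (X \<boxtimes> W) L" unfolding g0 using zero_comp obs L br by blast
    finally obtain h where h: "h \<in> Hom C (K \<boxtimes> W) L" "h \<bullet> (k \<boxdot> Idm C W) = g \<bullet> ?bY"
      using cokernel_factor[OF right L gb] by blast
    have "(h \<bullet> ?rK) \<bullet> (Idm C W \<boxdot> k) = h \<bullet> (?rK \<bullet> (Idm C W \<boxdot> k))"
      using comp_assoc obs L h br arrs by blast
    also have "\<dots> = (h \<bullet> (k \<boxdot> Idm C W)) \<bullet> ?rY"
      unfolding nat_k using comp_assoc[OF obs(5,2,3) L br(5) arrs(2) h(1)] by simp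
    also have "\<dots> = g \<bullet> (?bY \<bullet> ?rY)"
      unfolding h using comp_assoc[OF obs(5,2,5) L br(5,2) g] by simp
    also have "\<dots> = g" using symmetry[OF W Y] comp_id[OF obs(5) L g] by simp
    finally have ex: "(h \<bullet> ?rK) \<bullet> (Idm C W \<boxdot> k) = g" .
    have hin: "h \<bullet> ?rK \<in> Hom C (W \<boxtimes> K) L" using h br obs L comp_in by blast
    \<comment> \<open>Precomposing with \<open>?bK\<close> carries the equation to the right-handed
      cokernel, where it cancels; \<open>?rK\<close> undoes the change.\<close>
    have "x = y" if x: "x \<in> Hom C (W \<boxtimes> K) L" and y: "y \<in> Hom C (W \<boxtimes> K) L"
      and eq: "x \<bullet> (Idm C W \<boxdot> k) = y \<bullet> (Idm C W \<boxdot> k)" for x y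
    proof -
      have move: "(z \<bullet> ?bK) \<bullet> (k \<boxdot> Idm C W) = (z \<bullet> (Idm C W \<boxdot> k)) \<bullet> ?bY"
        and undo: "(z \<bullet> ?bK) \<bullet> ?rK = z" if z: "z \<in> Hom C (W \<boxtimes> K) L" for z
      proof -
        have "(z \<bullet> ?bK) \<bullet> (k \<boxdot> Idm C W) = z \<bullet> (?bK \<bullet> (k \<boxdot> Idm C W))"
          using comp_assoc obs L z br arrs by blast
        also have "\<dots> = (z \<bullet> (Idm C W \<boxdot> k)) \<bullet> ?bY"
          unfolding nat_k using comp_assoc[OF obs(2,5,6) L br(2) arrs(4) z] by simp
        finally show "(z \<bullet> ?bK) \<bullet> (k \<boxdot> Idm C W) = (z \<bullet> (Idm C W \<boxdot> k)) \<bullet> ?bY" .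
        show "(z \<bullet> ?bK) \<bullet> ?rK = z"
          using comp_assoc[OF obs(6,3,6) L br(6,3) z] symmetry[OF W K(1)] comp_id[OF obs(6) L z]
          by simp
      qed
      have "x \<bullet> ?bK \<in> Hom C (K \<boxtimes> W) L" "y \<bullet> ?bK \<in> Hom C (K \<boxtimes> W) L"
        using x y br obs L comp_in by blast+
      then have "x \<bullet> ?bK = y \<bullet> ?bK"
        using cokernel_cancel[OF right obs(1,2) arrs(1) L] move x y eq by metis
      then show "x = y" using undo x y by metis
    qed
    then show ?thesis using ex hin by metis
  qed
  then show ?thesis using zero arrs obs by (auto simp: is_cokernel_def)
qed

end


subsection \<open>Commutative monoids and their endomorphisms\<close>

context symmetric_monoidal_category
begin

lemma comm_monoidD:
  assumes "A \<in> Obj (Comm C)"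
  shows "mon_carrier A \<in> Obj C"
    and "mon_mult A \<in> Hom C (mon_carrier A \<boxtimes> mon_carrier A) (mon_carrier A)"
    and "mon_unit A \<in> Hom C (unit_ob C) (mon_carrier A)"
    and "mon_mult A \<bullet> (mon_mult A \<boxdot> Idm C (mon_carrier A)) = mon_mult A \<bullet>
      (Idm C (mon_carrier A) \<boxdot> mon_mult A) \<bullet>
      associator C (mon_carrier A) (mon_carrier A) (mon_carrier A)"
    and "mon_mult A \<bullet> (mon_unit A \<boxdot> Idm C (mon_carrier A)) = left_unitor C (mon_carrier A)"
    and "mon_mult A \<bullet> braiding C (mon_carrier A) (mon_carrier A) = mon_mult A"
  using assms by (auto simp: Comm_def is_comm_monoid_def Let_def)

lemma Comm_Hom_iff:
  "f \<in> Hom (Comm C) A B \<longleftrightarrow> f \<in> Hom C (mon_carrier A) (mon_carrier B) \<and>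
     f \<bullet> mon_mult A = mon_mult B \<bullet> (f \<boxdot> f) \<and> f \<bullet> mon_unit A = mon_unit B"
  by (simp add: Comm_def)

lemma Comm_Cmp: "g \<bullet>\<^bsub>Comm C\<^esub> f = g \<bullet> f"
  and Comm_Idm: "Idm (Comm C) A = Idm C (mon_carrier A)"
  by (simp_all add: Comm_def)

lemma category_Comm: "category (Comm C)"
proof
  fix A assume "A \<in> Obj (Comm C)"
  note A = comm_monoidD[OF this]
  then show "Idm (Comm C) A \<in> Hom (Comm C) A A"
    using tensor_id[OF A(1) A(1)] id_in[OF A(1)] comp_id[OF _ _ A(2)] id_comp[OF _ _ A(2)]
      id_comp[OF _ _ A(3)] tensor_ob[OF A(1) A(1)] unit_ob
    by (simp add: Comm_Hom_iff Comm_Idm)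
next
  fix A B D f g
  assume obj: "A \<in> Obj (Comm C)" "B \<in> Obj (Comm C)" "D \<in> Obj (Comm C)"
    and f: "f \<in> Hom (Comm C) A B" and g: "g \<in> Hom (Comm C) B D"
  note A = comm_monoidD[OF obj(1)] and B = comm_monoidD[OF obj(2)] and D = comm_monoidD[OF obj(3)]
  let ?X = "mon_carrier A" and ?Y = "mon_carrier B" and ?Z = "mon_carrier D"
  have f': "f \<in> Hom C ?X ?Y" "f \<bullet> mon_mult A = mon_mult B \<bullet> (f \<boxdot> f)" "f \<bullet> mon_unit A = mon_unit B"
    and g': "g \<in> Hom C ?Y ?Z" "g \<bullet> mon_mult B = mon_mult D \<bullet> (g \<boxdot> g)" "g \<bullet> mon_unit B = mon_unit D"
    using f g by (auto simp: Comm_Hom_iff)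
  note XX = tensor_ob[OF A(1) A(1)] and YY = tensor_ob[OF B(1) B(1)] and ZZ = tensor_ob[OF D(1) D(1)]
  have ff: "f \<boxdot> f \<in> Hom C (?X \<boxtimes> ?X) (?Y \<boxtimes> ?Y)" and gg: "g \<boxdot> g \<in> Hom C (?Y \<boxtimes> ?Y) (?Z \<boxtimes> ?Z)"
    using tensor_arr A B D f' g' by blast+
  have "(g \<bullet> f) \<bullet> mon_mult A = g \<bullet> (mon_mult B \<bullet> (f \<boxdot> f))"
    using comp_assoc[OF XX A(1) B(1) D(1) A(2) f'(1) g'(1)] f' by simp
  also have "\<dots> = (mon_mult D \<bullet> (g \<boxdot> g)) \<bullet> (f \<boxdot> f)"
    using comp_assoc[OF XX YY B(1) D(1) ff B(2) g'(1)] g' by simp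
  also have "\<dots> = mon_mult D \<bullet> ((g \<bullet> f) \<boxdot> (g \<bullet> f))"
    using comp_assoc[OF XX YY ZZ D(1) ff gg D(2)]
      tensor_comp[OF A(1) B(1) D(1) A(1) B(1) D(1) f'(1) g'(1) f'(1) g'(1)] by simp
  finally have "(g \<bullet> f) \<bullet> mon_mult A = mon_mult D \<bullet> ((g \<bullet> f) \<boxdot> (g \<bullet> f))" .
  moreover have "(g \<bullet> f) \<bullet> mon_unit A = mon_unit D"
    using comp_assoc[OF unit_ob A(1) B(1) D(1) A(3) f'(1) g'(1)] f' g' by simp
  moreover have "g \<bullet> f \<in> Hom C ?X ?Z" using comp_in A B D f' g' by blast
  ultimately show "g \<bullet>\<^bsub>Comm C\<^esub> f \<in> Hom (Comm C) A D"
    by (simp add: Comm_Hom_iff Comm_Cmp)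
next
  fix A B f
  assume "A \<in> Obj (Comm C)" "B \<in> Obj (Comm C)" "f \<in> Hom (Comm C) A B"
  then show "f \<bullet>\<^bsub>Comm C\<^esub> Idm (Comm C) A = f" "Idm (Comm C) B \<bullet>\<^bsub>Comm C\<^esub> f = f"
    using comp_id[OF comm_monoidD(1) comm_monoidD(1)] id_comp[OF comm_monoidD(1) comm_monoidD(1)]
    by (simp_all add: Comm_Hom_iff Comm_Cmp Comm_Idm)
next
  fix A B D E f g h
  assume "A \<in> Obj (Comm C)" "B \<in> Obj (Comm C)" "D \<in> Obj (Comm C)" "E \<in> Obj (Comm C)"
    "f \<in> Hom (Comm C) A B" "g \<in> Hom (Comm C) B D" "h \<in> Hom (Comm C) D E"
  then show "(h \<bullet>\<^bsub>Comm C\<^esub> g) \<bullet>\<^bsub>Comm C\<^esub> f = h \<bullet>\<^bsub>Comm C\<^esub> (g \<bullet>\<^bsub>Comm C\<^esub> f)"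
    using comp_assoc[OF comm_monoidD(1) comm_monoidD(1) comm_monoidD(1) comm_monoidD(1)]
    by (simp add: Comm_Hom_iff Comm_Cmp)
qed

lemma End_ring_carrier_iff:
  "t \<in> carrier (End_ring C A) \<longleftrightarrow> t \<in> Hom C (mon_carrier A) (mon_carrier A) \<and>
     t \<bullet> mon_mult A = mon_mult A \<bullet> (Idm C (mon_carrier A) \<boxdot> t)"
  by (simp add: End_ring_def Modules_def regular_module_def Let_def)

text \<open>Commutativity of the multiplication trades one factor for the other: a braiding is
  inserted, \<open>t\<close> slides through it by naturality, and the braiding is absorbed
  again.\<close>

lemma End_ring_linear_left:
  assumes A: "A \<in> Obj (Comm C)" and t: "t \<in> carrier (End_ring C A)"
  shows "t \<bullet> mon_mult A = mon_mult A \<bullet> (t \<boxdot> Idm C (mon_carrier A))"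
proof -
  let ?X = "mon_carrier A" and ?m = "mon_mult A"
  let ?b = "braiding C ?X ?X"
  note A = comm_monoidD[OF A]
  have t: "t \<in> Hom C ?X ?X" "t \<bullet> ?m = ?m \<bullet> (Idm C ?X \<boxdot> t)"
    using t by (auto simp: End_ring_carrier_iff)
  note XX = tensor_ob[OF A(1) A(1)] and b = braiding_in[OF A(1) A(1)] and i = id_in[OF A(1)]
  have t1: "t \<boxdot> Idm C ?X \<in> Hom C (?X \<boxtimes> ?X) (?X \<boxtimes> ?X)" and t2: "Idm C ?X \<boxdot> t \<in> Hom C (?X \<boxtimes> ?X) (?X \<boxtimes> ?X)"
    using tensor_arr A t i by blast+
  have "t \<bullet> ?m = t \<bullet> (?m \<bullet> ?b)" using A by simp
  also have "\<dots> = (?m \<bullet> (Idm C ?X \<boxdot> t)) \<bullet> ?b"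
    using comp_assoc[OF XX XX A(1) A(1) b A(2) t(1)] t by simp
  also have "\<dots> = ?m \<bullet> (?b \<bullet> (t \<boxdot> Idm C ?X))"
    using comp_assoc[OF XX XX XX A(1) b t2 A(2)]
      braiding_natural[OF A(1) A(1) A(1) A(1) t(1) i] by simp
  also have "\<dots> = ?m \<bullet> (t \<boxdot> Idm C ?X)"
    using comp_assoc[OF XX XX XX A(1) t1 b A(2)] A by simp
  finally show ?thesis .
qed

text \<open>An Eckmann--Hilton argument: both composites equal \<open>s \<otimes> t\<close> after the multiplication, and the
  multiplication is a split epimorphism.\<close>

lemma End_ring_commute:
  assumes obA: "A \<in> Obj (Comm C)" and s: "s \<in> carrier (End_ring C A)"
    and t: "t \<in> carrier (End_ring C A)"
  shows "s \<bullet> t = t \<bullet> s"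
proof -
  let ?X = "mon_carrier A" and ?m = "mon_mult A" and ?e = "mon_unit A"
  note A = comm_monoidD[OF obA]
  have s': "s \<in> Hom C ?X ?X" and t': "t \<in> Hom C ?X ?X"
    using s t by (auto simp: End_ring_carrier_iff)
  \<comment> \<open>Letting \<open>s\<close> act on the left factor and \<open>t\<close> on the
    right one makes the order irrelevant by the interchange law.\<close>
  have sm: "s \<bullet> ?m = ?m \<bullet> (s \<boxdot> Idm C ?X)" using End_ring_linear_left obA s by blast
  have tm: "t \<bullet> ?m = ?m \<bullet> (Idm C ?X \<boxdot> t)" using t by (simp add: End_ring_carrier_iff)
  note XX = tensor_ob[OF A(1) A(1)] and i = id_in[OF A(1)]
  have s1: "s \<boxdot> Idm C ?X \<in> Hom C (?X \<boxtimes> ?X) (?X \<boxtimes> ?X)"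
    and t2: "Idm C ?X \<boxdot> t \<in> Hom C (?X \<boxtimes> ?X) (?X \<boxtimes> ?X)"
    using tensor_arr A s' t' i by blast+
  have "(s \<bullet> t) \<bullet> ?m = s \<bullet> (?m \<bullet> (Idm C ?X \<boxdot> t))"
    using comp_assoc[OF XX A(1) A(1) A(1) A(2) t' s'] tm by simp
  also have "\<dots> = (?m \<bullet> (s \<boxdot> Idm C ?X)) \<bullet> (Idm C ?X \<boxdot> t)"
    using comp_assoc[OF XX XX A(1) A(1) t2 A(2) s'] sm by simp
  also have "\<dots> = ?m \<bullet> (s \<boxdot> t)"
    using comp_assoc[OF XX XX XX A(1) t2 s1 A(2)]
      tensor_comp[OF A(1) A(1) A(1) A(1) A(1) A(1) i s' t' i] comp_id[OF A(1) A(1) s']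
      id_comp[OF A(1) A(1) t'] by simp
  finally have st: "(s \<bullet> t) \<bullet> ?m = ?m \<bullet> (s \<boxdot> t)" .
  have "(t \<bullet> s) \<bullet> ?m = t \<bullet> (?m \<bullet> (s \<boxdot> Idm C ?X))"
    using comp_assoc[OF XX A(1) A(1) A(1) A(2) s' t'] sm by simp
  also have "\<dots> = (?m \<bullet> (Idm C ?X \<boxdot> t)) \<bullet> (s \<boxdot> Idm C ?X)"
    using comp_assoc[OF XX XX A(1) A(1) s1 A(2) t'] tm by simp
  also have "\<dots> = ?m \<bullet> (s \<boxdot> t)"
    using comp_assoc[OF XX XX XX A(1) s1 t2 A(2)]
      tensor_comp[OF A(1) A(1) A(1) A(1) A(1) A(1) s' i i t'] id_comp[OF A(1) A(1) s']
      comp_id[OF A(1) A(1) t'] by simp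
  finally have eq: "(s \<bullet> t) \<bullet> ?m = (t \<bullet> s) \<bullet> ?m" using st by simp
  obtain l where l: "left_unitor C ?X \<in> Hom C (unit_ob C \<boxtimes> ?X) ?X"
    "l \<in> Hom C ?X (unit_ob C \<boxtimes> ?X)" "left_unitor C ?X \<bullet> l = Idm C ?X"
    using isomorphism_inverse[OF left_unitor_iso[OF A(1)]] by metis
  note IX = tensor_ob[OF unit_ob A(1)]
  have e1: "?e \<boxdot> Idm C ?X \<in> Hom C (unit_ob C \<boxtimes> ?X) (?X \<boxtimes> ?X)"
    using tensor_arr A unit_ob i by blast
  \<comment> \<open>The section of the multiplication is multiplication's left unit law read
    backwards: informally, it sends \<open>a\<close> to \<open>1 \<otimes> a\<close>.\<close>
  have split: "?m \<bullet> ((?e \<boxdot> Idm C ?X) \<bullet> l) = Idm C ?X"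
    using comp_assoc[OF A(1) IX XX A(1) l(2) e1 A(2)] A l by simp
  have sec: "(?e \<boxdot> Idm C ?X) \<bullet> l \<in> Hom C ?X (?X \<boxtimes> ?X)"
    using comp_in[OF A(1) IX XX l(2) e1] .
  have cancel: "(x \<bullet> ?m) \<bullet> ((?e \<boxdot> Idm C ?X) \<bullet> l) = x" if "x \<in> Hom C ?X ?X" for x
    using comp_assoc[OF A(1) XX A(1) A(1) sec A(2) that] split comp_id[OF A(1) A(1) that] by simp
  have "s \<bullet> t \<in> Hom C ?X ?X" "t \<bullet> s \<in> Hom C ?X ?X" using comp_in A s' t' by blast+
  then show ?thesis using cancel eq by metis
qed

end


subsection \<open>Quotients by one element\<close>

context standing_assumptions
begin

text \<open>The cokernel of \<open>t\<close> in the ambient category carries a module structure, because tensoring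
  with \<open>A\<close> preserves it; hence it is also the cokernel in the category of modules.\<close>

lemma cokernel_module:
  assumes obA: "A \<in> Obj (Comm C)" and t: "t \<in> carrier (End_ring C A)"
    and cok: "is_cokernel C (mon_carrier A) (mon_carrier A) t K k"
  obtains r where "\<lparr>mod_carrier = K, mod_act = r\<rparr> \<in> Obj (Modules C A)"
    "k \<in> Hom (Modules C A) (regular_module A) \<lparr>mod_carrier = K, mod_act = r\<rparr>"
proof -
  let ?X = "mon_carrier A" and ?m = "mon_mult A" and ?e = "mon_unit A" and ?I = "unit_ob C"
  let ?i = "Idm C (mon_carrier A)" and ?iK = "Idm C K"
  note A = comm_monoidD[OF obA]
  have t': "t \<in> Hom C ?X ?X" "t \<bullet> ?m = ?m \<bullet> (?i \<boxdot> t)"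
    using t by (auto simp: End_ring_carrier_iff)
  have K: "K \<in> Obj C" "k \<in> Hom C ?X K" "k \<bullet> t = hzero C ?X K"
    using cok by (auto simp: is_cokernel_def)
  note XX = tensor_ob[OF A(1) A(1)] and XK = tensor_ob[OF A(1) K(1)] and i = id_in[OF A(1)]
    and iK = id_in[OF K(1)] and IX = tensor_ob[OF unit_ob A(1)] and IK = tensor_ob[OF unit_ob K(1)]
  note XX_X = tensor_ob[OF XX A(1)] and X_XX = tensor_ob[OF A(1) XX]
    and XX_K = tensor_ob[OF XX K(1)] and X_XK = tensor_ob[OF A(1) XK]
  have it: "?i \<boxdot> t \<in> Hom C (?X \<boxtimes> ?X) (?X \<boxtimes> ?X)" and ik: "?i \<boxdot> k \<in> Hom C (?X \<boxtimes> ?X) (?X \<boxtimes> K)"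
    and mi: "?m \<boxdot> ?i \<in> Hom C ((?X \<boxtimes> ?X) \<boxtimes> ?X) (?X \<boxtimes> ?X)"
    and im: "?i \<boxdot> ?m \<in> Hom C (?X \<boxtimes> (?X \<boxtimes> ?X)) (?X \<boxtimes> ?X)"
    and mK: "?m \<boxdot> ?iK \<in> Hom C ((?X \<boxtimes> ?X) \<boxtimes> K) (?X \<boxtimes> K)"
    and ei: "?e \<boxdot> ?i \<in> Hom C (?I \<boxtimes> ?X) (?X \<boxtimes> ?X)"
    and eK: "?e \<boxdot> ?iK \<in> Hom C (?I \<boxtimes> K) (?X \<boxtimes> K)"
    and Ik: "Idm C ?I \<boxdot> k \<in> Hom C (?I \<boxtimes> ?X) (?I \<boxtimes> K)"
    and iik: "Idm C (?X \<boxtimes> ?X) \<boxdot> k \<in> Hom C ((?X \<boxtimes> ?X) \<boxtimes> ?X) ((?X \<boxtimes> ?X) \<boxtimes> K)"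
    and iik': "?i \<boxdot> (?i \<boxdot> k) \<in> Hom C (?X \<boxtimes> (?X \<boxtimes> ?X)) (?X \<boxtimes> (?X \<boxtimes> K))"
    using tensor_arr A K t' i iK unit_ob id_in XX XK by metis+
  have km: "k \<bullet> ?m \<in> Hom C (?X \<boxtimes> ?X) K" using comp_in XX A K by blast
  \<comment> \<open>By linearity of \<open>t\<close> this equals
    \<open>k \<bullet> t \<bullet> ?m\<close>, which is zero. Since \<open>?i \<boxdot> k\<close> is
    a cokernel of \<open>?i \<boxdot> t\<close>, the action \<open>r\<close> on \<open>K\<close> is
    the induced factorization.\<close>
  have "(k \<bullet> ?m) \<bullet> (?i \<boxdot> t) = k \<bullet> (t \<bullet> ?m)"
    using comp_assoc[OF XX XX A(1) K(1) it A(2) K(2)] t' by simp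
  also have "\<dots> = hzero C (?X \<boxtimes> ?X) K"
    using comp_assoc[OF XX A(1) A(1) K(1) A(2) t'(1) K(2)] K
      zero_comp[OF XX A(1) K(1) A(2)] by simp
  finally obtain r where r: "r \<in> Hom C (?X \<boxtimes> K) K" "r \<bullet> (?i \<boxdot> k) = k \<bullet> ?m"
    using cokernel_factor[OF cokernel_tensor_left[OF A(1) A(1) A(1) t'(1) cok] K(1) km] by blast
  have ir: "?i \<boxdot> r \<in> Hom C (?X \<boxtimes> (?X \<boxtimes> K)) (?X \<boxtimes> K)"
    using tensor_arr A K XK i r by blast
  have aX: "associator C ?X ?X ?X \<in> Hom C ((?X \<boxtimes> ?X) \<boxtimes> ?X) (?X \<boxtimes> (?X \<boxtimes> ?X))"
    and aK: "associator C ?X ?X K \<in> Hom C ((?X \<boxtimes> ?X) \<boxtimes> K) (?X \<boxtimes> (?X \<boxtimes> K))"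
    using associator_iso A K by (auto simp: is_isomorphism_def)
  have lX: "left_unitor C ?X \<in> Hom C (?I \<boxtimes> ?X) ?X" and lK: "left_unitor C K \<in> Hom C (?I \<boxtimes> K) K"
    using left_unitor_iso A K by (auto simp: is_isomorphism_def)
  \<comment> \<open>Associativity descends from \<open>A\<close>: both sides agree after
    \<open>Idm C (?X \<boxtimes> ?X) \<boxdot> k\<close>, which is a tensored cokernel and hence
    cancellable. The unit law below descends in the same way along
    \<open>Idm C ?I \<boxdot> k\<close>.\<close>
  have assoc: "r \<bullet> (?m \<boxdot> ?iK) = r \<bullet> (?i \<boxdot> r) \<bullet> associator C ?X ?X K"
  proof -
    have slide: "(?m \<boxdot> ?iK) \<bullet> (Idm C (?X \<boxtimes> ?X) \<boxdot> k) = (?i \<boxdot> k) \<bullet> (?m \<boxdot> ?i)"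
      using tensor_comp[OF XX XX A(1) A(1) K(1) K(1) id_in[OF XX] A(2) K(2) iK]
        tensor_comp[OF XX A(1) A(1) A(1) A(1) K(1) A(2) i i K(2)]
        comp_id[OF XX A(1) A(2)] id_comp[OF XX A(1) A(2)] comp_id[OF A(1) K(1) K(2)]
        id_comp[OF A(1) K(1) K(2)] by simp
    have "(r \<bullet> (?m \<boxdot> ?iK)) \<bullet> (Idm C (?X \<boxtimes> ?X) \<boxdot> k) = r \<bullet> ((?i \<boxdot> k) \<bullet> (?m \<boxdot> ?i))"
      using comp_assoc[OF XX_X XX_K XK K(1) iik mK r(1)] slide by simp
    also have "\<dots> = (k \<bullet> ?m) \<bullet> (?m \<boxdot> ?i)"
      using comp_assoc[OF XX_X XX XK K(1) mi ik r(1)] r by simp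
    also have "\<dots> = k \<bullet> (?m \<bullet> ((?i \<boxdot> ?m) \<bullet> associator C ?X ?X ?X))"
      using comp_assoc[OF XX_X XX A(1) K(1) mi A(2) K(2)] A by simp
    also have "\<dots> = (k \<bullet> ?m) \<bullet> ((?i \<boxdot> ?m) \<bullet> associator C ?X ?X ?X)"
      using comp_assoc[OF XX_X XX A(1) K(1) comp_in[OF XX_X X_XX XX aX im] A(2) K(2)] by simp
    finally have lhs: "(r \<bullet> (?m \<boxdot> ?iK)) \<bullet> (Idm C (?X \<boxtimes> ?X) \<boxdot> k)
      = (k \<bullet> ?m) \<bullet> ((?i \<boxdot> ?m) \<bullet> associator C ?X ?X ?X)" .
    have "(r \<bullet> (?i \<boxdot> r) \<bullet> associator C ?X ?X K) \<bullet> (Idm C (?X \<boxtimes> ?X) \<boxdot> k)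
        = r \<bullet> ((?i \<boxdot> r) \<bullet> (associator C ?X ?X K \<bullet> (Idm C (?X \<boxtimes> ?X) \<boxdot> k)))"
      using comp_assoc[OF XX_X XX_K XK K(1) iik comp_in[OF XX_K X_XK XK aK ir] r(1)]
        comp_assoc[OF XX_X XX_K X_XK XK iik aK ir] by simp
    also have "\<dots> = r \<bullet> ((?i \<boxdot> r) \<bullet> ((?i \<boxdot> (?i \<boxdot> k)) \<bullet> associator C ?X ?X ?X))"
      using associator_natural[OF A(1) A(1) A(1) A(1) A(1) K(1) i i K(2)] tensor_id[OF A(1) A(1)]
      by simp
    also have "\<dots> = r \<bullet> (((?i \<boxdot> r) \<bullet> (?i \<boxdot> (?i \<boxdot> k))) \<bullet> associator C ?X ?X ?X)"
      using comp_assoc[OF XX_X X_XX X_XK XK aX iik' ir] by simp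
    also have "(?i \<boxdot> r) \<bullet> (?i \<boxdot> (?i \<boxdot> k)) = (?i \<boxdot> k) \<bullet> (?i \<boxdot> ?m)"
      using tensor_comp[OF A(1) A(1) A(1) XX XK K(1) i i ik r(1)]
        tensor_comp[OF A(1) A(1) A(1) XX A(1) K(1) i i A(2) K(2)] r by simp
    also have "r \<bullet> (((?i \<boxdot> k) \<bullet> (?i \<boxdot> ?m)) \<bullet> associator C ?X ?X ?X)
        = (r \<bullet> (?i \<boxdot> k)) \<bullet> ((?i \<boxdot> ?m) \<bullet> associator C ?X ?X ?X)"
      using comp_assoc[OF XX_X X_XX XX XK aX im ik]
        comp_assoc[OF XX_X XX XK K(1) comp_in[OF XX_X X_XX XX aX im] ik r(1)] by simp
    finally have rhs: "(r \<bullet> (?i \<boxdot> r) \<bullet> associator C ?X ?X K) \<bullet> (Idm C (?X \<boxtimes> ?X) \<boxdot> k)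
      = (k \<bullet> ?m) \<bullet> ((?i \<boxdot> ?m) \<bullet> associator C ?X ?X ?X)" using r by simp
    have cokXX: "is_cokernel C ((?X \<boxtimes> ?X) \<boxtimes> ?X) ((?X \<boxtimes> ?X) \<boxtimes> ?X) (Idm C (?X \<boxtimes> ?X) \<boxdot> t)
        ((?X \<boxtimes> ?X) \<boxtimes> K) (Idm C (?X \<boxtimes> ?X) \<boxdot> k)"
      using cokernel_tensor_left[OF A(1) A(1) XX t'(1) cok] .
    show ?thesis
      using cokernel_cancel[OF cokXX XX_X XX_X tensor_arr[OF XX XX A(1) A(1) id_in[OF XX] t'(1)] K(1)
        comp_in[OF XX_K XK K(1) mK r(1)] comp_in[OF XX_K XK K(1) comp_in[OF XX_K X_XK XK aK ir] r(1)]]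
        lhs rhs by simp
  qed
  have unit: "r \<bullet> (?e \<boxdot> ?iK) = left_unitor C K"
  proof -
    have slide: "(?e \<boxdot> ?iK) \<bullet> (Idm C ?I \<boxdot> k) = (?i \<boxdot> k) \<bullet> (?e \<boxdot> ?i)"
      using tensor_comp[OF unit_ob unit_ob A(1) A(1) K(1) K(1) id_in[OF unit_ob] A(3) K(2) iK]
        tensor_comp[OF unit_ob A(1) A(1) A(1) A(1) K(1) A(3) i i K(2)]
        comp_id[OF unit_ob A(1) A(3)] id_comp[OF unit_ob A(1) A(3)] comp_id[OF A(1) K(1) K(2)]
        id_comp[OF A(1) K(1) K(2)] by simp
    have "(r \<bullet> (?e \<boxdot> ?iK)) \<bullet> (Idm C ?I \<boxdot> k) = r \<bullet> ((?i \<boxdot> k) \<bullet> (?e \<boxdot> ?i))"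
      using comp_assoc[OF IX IK XK K(1) Ik eK r(1)] slide by simp
    also have "\<dots> = (k \<bullet> ?m) \<bullet> (?e \<boxdot> ?i)"
      using comp_assoc[OF IX XX XK K(1) ei ik r(1)] r by simp
    also have "\<dots> = k \<bullet> left_unitor C ?X"
      using comp_assoc[OF IX XX A(1) K(1) ei A(2) K(2)] A by simp
    also have "\<dots> = left_unitor C K \<bullet> (Idm C ?I \<boxdot> k)"
      using left_unitor_natural[OF A(1) K(1) K(2)] by simp
    finally show ?thesis
      using cokernel_cancel[OF cokernel_tensor_left[OF A(1) A(1) unit_ob t'(1) cok] IX IX
        tensor_arr[OF unit_ob unit_ob A(1) A(1) id_in[OF unit_ob] t'(1)] K(1)
        comp_in[OF IK XK K(1) eK r(1)] lK] by simp
  qed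
  have "\<lparr>mod_carrier = K, mod_act = r\<rparr> \<in> Obj (Modules C A)"
    using K r assoc unit by (simp add: Modules_def is_module_def Let_def)
  moreover have "k \<in> Hom (Modules C A) (regular_module A) \<lparr>mod_carrier = K, mod_act = r\<rparr>"
    using K r by (simp add: Modules_def regular_module_def)
  ultimately show ?thesis using that by blast
qed

text \<open>The ambient cokernel \<open>K\<close> is now a module, so the property of
  \<open>N\<close> yields \<open>h\<close> from \<open>N\<close> to \<open>K\<close>, while that of
  \<open>K\<close> yields \<open>g\<close> back. Once \<open>g\<close> is linear,
  \<open>g \<bullet> h\<close> is a module endomorphism of \<open>N\<close> fixing \<open>q\<close>,
  hence the identity. Factorizations through \<open>K\<close> are then carried to \<open>N\<close>
  by \<open>h\<close>, and uniqueness is carried back by \<open>g\<close>.\<close>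

lemma module_cokernel_is_cokernel:
  assumes obA: "A \<in> Obj (Comm C)" and t: "t \<in> carrier (End_ring C A)"
    and cokN: "is_cokernel (Modules C A) (regular_module A) (regular_module A) t N q"
  shows "is_cokernel C (mon_carrier A) (mon_carrier A) t (mod_carrier N) q"
proof -
  let ?X = "mon_carrier A" and ?m = "mon_mult A" and ?N = "mod_carrier N" and ?n = "mod_act N"
  let ?i = "Idm C (mon_carrier A)" and ?M = "Modules C A" and ?R = "regular_module A"
  note A = comm_monoidD[OF obA]
  have t': "t \<in> Hom C ?X ?X" using t by (auto simp: End_ring_carrier_iff)
  have N: "N \<in> Obj ?M" "?N \<in> Obj C" "?n \<in> Hom C (?X \<boxtimes> ?N) ?N"
    using cokN by (auto simp: is_cokernel_def Modules_def is_module_def Let_def)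
  have q: "q \<in> Hom ?M ?R N" "q \<in> Hom C ?X ?N" "q \<bullet> ?m = ?n \<bullet> (?i \<boxdot> q)" "q \<bullet> t = hzero C ?X ?N"
    using cokN by (auto simp: is_cokernel_def Modules_def regular_module_def)
  have factM: "\<exists>!h. h \<in> Hom ?M N Z \<and> h \<bullet> q = g"
    if "Z \<in> Obj ?M" "g \<in> Hom ?M ?R Z" "g \<bullet> t = hzero C ?X (mod_carrier Z)" for Z g
  proof -
    have "Cmp ?M = Cmp C" "hzero ?M ?R Z = hzero C ?X (mod_carrier Z)"
      by (simp_all add: Modules_def regular_module_def)
    then show ?thesis using cokN that unfolding is_cokernel_def by metis
  qed
  obtain K k where cok: "is_cokernel C ?X ?X t K k"
    using cokernel A t' by blast
  then have K: "K \<in> Obj C" "k \<in> Hom C ?X K" "k \<bullet> t = hzero C ?X K"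
    by (auto simp: is_cokernel_def)
  obtain r where r: "\<lparr>mod_carrier = K, mod_act = r\<rparr> \<in> Obj ?M"
    "k \<in> Hom ?M ?R \<lparr>mod_carrier = K, mod_act = r\<rparr>"
    using cokernel_module[OF obA t cok] .
  have r': "r \<in> Hom C (?X \<boxtimes> K) K" "k \<bullet> ?m = r \<bullet> (?i \<boxdot> k)"
    using r by (auto simp: Modules_def is_module_def regular_module_def Let_def)
  obtain h where h: "h \<in> Hom ?M N \<lparr>mod_carrier = K, mod_act = r\<rparr>" "h \<bullet> q = k"
    using factM[OF r] K by auto
  have h': "h \<in> Hom C ?N K" "h \<bullet> ?n = r \<bullet> (?i \<boxdot> h)"
    using h by (auto simp: Modules_def)
  obtain g where g: "g \<in> Hom C K ?N" "g \<bullet> k = q"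
    using cokernel_factor[OF cok N(2) q(2,4)] .
  note XX = tensor_ob[OF A(1) A(1)] and XK = tensor_ob[OF A(1) K(1)] and XN = tensor_ob[OF A(1) N(2)]
    and i = id_in[OF A(1)]
  have ig: "?i \<boxdot> g \<in> Hom C (?X \<boxtimes> K) (?X \<boxtimes> ?N)" and ik: "?i \<boxdot> k \<in> Hom C (?X \<boxtimes> ?X) (?X \<boxtimes> K)"
    and ih: "?i \<boxdot> h \<in> Hom C (?X \<boxtimes> ?N) (?X \<boxtimes> K)"
    using tensor_arr A K N g h' i by blast+
  \<comment> \<open>Linearity is tested after the cancellable \<open>?i \<boxdot> k\<close>, where
    both sides become \<open>q \<bullet> ?m\<close>.\<close>
  have linear: "g \<bullet> r = ?n \<bullet> (?i \<boxdot> g)"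
  proof -
    have "(g \<bullet> r) \<bullet> (?i \<boxdot> k) = q \<bullet> ?m"
      using comp_assoc[OF XX XK K(1) N(2) ik r'(1) g(1)]
        comp_assoc[OF XX A(1) K(1) N(2) A(2) K(2) g(1)] r' g by simp
    also have "\<dots> = (?n \<bullet> (?i \<boxdot> g)) \<bullet> (?i \<boxdot> k)"
      using comp_assoc[OF XX XK XN N(2) ik ig N(3)] comp_id[OF A(1) A(1) i]
        tensor_comp[OF A(1) A(1) A(1) A(1) K(1) N(2) i i K(2) g(1)] q g by simp
    finally show ?thesis
      using cokernel_cancel[OF cokernel_tensor_left[OF A(1) A(1) A(1) t' cok] XX XX
        tensor_arr[OF A(1) A(1) A(1) A(1) i t'] N(2) comp_in[OF XK K(1) N(2) r'(1) g(1)]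
        comp_in[OF XK XN N(2) ig N(3)]] by simp
  qed
  have gh: "g \<bullet> h \<in> Hom C ?N ?N" using comp_in K N g h' by blast
  have "(g \<bullet> h) \<bullet> ?n = ?n \<bullet> (?i \<boxdot> (g \<bullet> h))"
    using comp_assoc[OF XN N(2) K(1) N(2) N(3) h'(1) g(1)] comp_assoc[OF XN XK K(1) N(2) ih r'(1) g(1)]
      comp_assoc[OF XN XK XN N(2) ih ig N(3)] h' linear comp_id[OF A(1) A(1) i]
      tensor_comp[OF A(1) A(1) A(1) N(2) K(1) N(2) i i h'(1) g(1)] by simp
  then have "g \<bullet> h \<in> Hom ?M N N" using gh by (simp add: Modules_def)
  moreover have "Idm C ?N \<in> Hom ?M N N"
    using id_in[OF N(2)] id_comp[OF XN N(2) N(3)] comp_id[OF XN N(2) N(3)] tensor_id[OF A(1) N(2)]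
    by (simp add: Modules_def)
  moreover have "(g \<bullet> h) \<bullet> q = q"
    using comp_assoc[OF A(1) N(2) K(1) N(2) q(2) h'(1) g(1)] h g by simp
  moreover have "Idm C ?N \<bullet> q = q" using id_comp[OF A(1) N(2) q(2)] .
  ultimately have gh_id: "g \<bullet> h = Idm C ?N" using factM[OF N(1) q(1,4)] by blast
  have "\<exists>!x. x \<in> Hom C ?N Z \<and> x \<bullet> q = y"
    if Z: "Z \<in> Obj C" and y: "y \<in> Hom C ?X Z" "y \<bullet> t = hzero C ?X Z" for Z y
  proof -
    obtain w where w: "w \<in> Hom C K Z" "w \<bullet> k = y" using cokernel_factor[OF cok Z y] .
    have "(w \<bullet> h) \<bullet> q = y" "w \<bullet> h \<in> Hom C ?N Z"
      using comp_assoc[OF A(1) N(2) K(1) Z q(2) h'(1) w(1)] h w comp_in[OF N(2) K(1) Z h'(1) w(1)]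
      by simp_all
    moreover have "x = x'" if x: "x \<in> Hom C ?N Z" "x' \<in> Hom C ?N Z" and eq: "x \<bullet> q = x' \<bullet> q" for x x'
    proof -
      have "(x \<bullet> g) \<bullet> k = (x' \<bullet> g) \<bullet> k"
        using comp_assoc[OF A(1) K(1) N(2) Z K(2) g(1)] x eq g by simp
      then have "x \<bullet> g = x' \<bullet> g"
        using cokernel_cancel[OF cok A(1) A(1) t' Z] comp_in[OF K(1) N(2) Z g(1)] x by blast
      then have "x \<bullet> (g \<bullet> h) = x' \<bullet> (g \<bullet> h)"
        using comp_assoc[OF N(2) K(1) N(2) Z h'(1) g(1)] x by metis
      then show "x = x'" using gh_id comp_id[OF N(2) Z] x by simp
    qed
    ultimately show ?thesis by metis
  qed
  then show ?thesis using N q by (simp add: is_cokernel_def)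
qed

lemma element_quotient_cokernel:
  assumes "A \<in> Obj (Comm C)" "t \<in> carrier (End_ring C A)" "is_element_quotient C A t Q q"
  shows "is_cokernel C (mon_carrier A) (mon_carrier A) t (mon_carrier Q) q"
  using assms module_cokernel_is_cokernel unfolding is_element_quotient_def by metis

text \<open>Monoid morphisms are ambient morphisms with the same composition, so cancellation in the
  ambient category suffices.\<close>

lemma element_quotient_epi:
  assumes obA: "A \<in> Obj (Comm C)" and t: "t \<in> carrier (End_ring C A)"
    and quot: "is_element_quotient C A t Q q"
  shows "is_epi (Comm C) A Q q"
proof -
  have t': "t \<in> Hom C (mon_carrier A) (mon_carrier A)"
    using t by (simp add: End_ring_carrier_iff)
  note A = comm_monoidD(1)[OF obA]
  have "x = y" if "B \<in> Obj (Comm C)" "x \<in> Hom (Comm C) Q B" "y \<in> Hom (Comm C) Q B"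
    "x \<bullet> q = y \<bullet> q" for B x y
    using cokernel_cancel[OF element_quotient_cokernel[OF assms] A A t' comm_monoidD(1)] that
    by (simp add: Comm_Hom_iff)
  then show ?thesis
    using quot by (auto simp: is_epi_def inj_on_def Comm_Cmp is_element_quotient_def)
qed

text \<open>The ambient factorization \<open>h\<close> is multiplicative because the required
  equation holds after \<open>q \<boxdot> q\<close>, by multiplicativity of \<open>f\<close> and
  \<open>q\<close>, and \<open>q \<boxdot> q\<close> can be cancelled.\<close>

lemma element_quotient_factor:
  assumes obA: "A \<in> Obj (Comm C)" and t: "t \<in> carrier (End_ring C A)"
    and quot: "is_element_quotient C A t Q q"
    and obB: "B \<in> Obj (Comm C)" and f: "f \<in> Hom (Comm C) A B"
    and ft: "f \<bullet> t = hzero C (mon_carrier A) (mon_carrier B)"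
  obtains h where "h \<in> Hom (Comm C) Q B" "h \<bullet> q = f"
proof -
  let ?X = "mon_carrier A" and ?Y = "mon_carrier Q" and ?Z = "mon_carrier B"
  let ?mX = "mon_mult A" and ?mY = "mon_mult Q" and ?mZ = "mon_mult B"
  note cok = element_quotient_cokernel[OF obA t quot]
  have obQ: "Q \<in> Obj (Comm C)" using quot by (simp add: is_element_quotient_def)
  note A = comm_monoidD[OF obA] and B = comm_monoidD[OF obB] and Q = comm_monoidD[OF obQ]
  have q: "q \<in> Hom C ?X ?Y" "q \<bullet> ?mX = ?mY \<bullet> (q \<boxdot> q)" "q \<bullet> mon_unit A = mon_unit Q"
    using quot by (auto simp: is_element_quotient_def Comm_Hom_iff)
  have f': "f \<in> Hom C ?X ?Z" "f \<bullet> ?mX = ?mZ \<bullet> (f \<boxdot> f)" "f \<bullet> mon_unit A = mon_unit B"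
    using f by (auto simp: Comm_Hom_iff)
  have t': "t \<in> Hom C ?X ?X" using t by (simp add: End_ring_carrier_iff)
  obtain h where h: "h \<in> Hom C ?Y ?Z" "h \<bullet> q = f"
    using cokernel_factor[OF cok B(1) f'(1) ft] .
  note XX = tensor_ob[OF A(1) A(1)] and XY = tensor_ob[OF A(1) Q(1)] and YY = tensor_ob[OF Q(1) Q(1)]
    and ZZ = tensor_ob[OF B(1) B(1)] and iX = id_in[OF A(1)] and iY = id_in[OF Q(1)]
  have qq: "q \<boxdot> q \<in> Hom C (?X \<boxtimes> ?X) (?Y \<boxtimes> ?Y)" and hh: "h \<boxdot> h \<in> Hom C (?Y \<boxtimes> ?Y) (?Z \<boxtimes> ?Z)"
    and iq: "Idm C ?X \<boxdot> q \<in> Hom C (?X \<boxtimes> ?X) (?X \<boxtimes> ?Y)"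
    and qi: "q \<boxdot> Idm C ?Y \<in> Hom C (?X \<boxtimes> ?Y) (?Y \<boxtimes> ?Y)"
    using tensor_arr A Q B q h iX iY by blast+
  have "(h \<bullet> ?mY) \<bullet> (q \<boxdot> q) = f \<bullet> ?mX"
    using comp_assoc[OF XX YY Q(1) B(1) qq Q(2) h(1)] comp_assoc[OF XX A(1) Q(1) B(1) A(2) q(1) h(1)]
      q h by simp
  also have "\<dots> = (?mZ \<bullet> (h \<boxdot> h)) \<bullet> (q \<boxdot> q)"
    using comp_assoc[OF XX YY ZZ B(1) qq hh B(2)] f' h
      tensor_comp[OF A(1) Q(1) B(1) A(1) Q(1) B(1) q(1) h(1) q(1) h(1)] by simp
  finally have eq: "(h \<bullet> ?mY) \<bullet> (q \<boxdot> q) = (?mZ \<bullet> (h \<boxdot> h)) \<bullet> (q \<boxdot> q)" .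
  \<comment> \<open>Splitting into one factor at a time exhibits \<open>q \<boxdot> q\<close> as a
    composite of two tensored cokernels, each cancellable.\<close>
  have "q \<boxdot> q = (q \<boxdot> Idm C ?Y) \<bullet> (Idm C ?X \<boxdot> q)"
    using tensor_comp[OF A(1) A(1) Q(1) A(1) Q(1) Q(1) iX q(1) q(1) iY] comp_id[OF A(1) Q(1) q(1)]
      id_comp[OF A(1) Q(1) q(1)] by simp
  moreover have "x = y" if x: "x \<in> Hom C (?Y \<boxtimes> ?Y) ?Z" and y: "y \<in> Hom C (?Y \<boxtimes> ?Y) ?Z"
    and "x \<bullet> ((q \<boxdot> Idm C ?Y) \<bullet> (Idm C ?X \<boxdot> q)) = y \<bullet> ((q \<boxdot> Idm C ?Y) \<bullet> (Idm C ?X \<boxdot> q))" for x y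
  proof -
    have "(x \<bullet> (q \<boxdot> Idm C ?Y)) \<bullet> (Idm C ?X \<boxdot> q) = (y \<bullet> (q \<boxdot> Idm C ?Y)) \<bullet> (Idm C ?X \<boxdot> q)"
      using that comp_assoc[OF XX XY YY B(1) iq qi] by simp
    then have "x \<bullet> (q \<boxdot> Idm C ?Y) = y \<bullet> (q \<boxdot> Idm C ?Y)"
      using cokernel_cancel[OF cokernel_tensor_left[OF A(1) A(1) A(1) t' cok] XX XX
        tensor_arr[OF A(1) A(1) A(1) A(1) iX t'] B(1)] comp_in[OF XY YY B(1) qi] x y by blast
    then show "x = y"
      using cokernel_cancel[OF cokernel_tensor_right[OF A(1) A(1) Q(1) t' cok] XY XY
        tensor_arr[OF A(1) A(1) Q(1) Q(1) t' iY] B(1) x y] by blast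
  qed
  ultimately have "h \<bullet> ?mY = ?mZ \<bullet> (h \<boxdot> h)"
    using eq comp_in[OF YY Q(1) B(1) Q(2) h(1)] comp_in[OF YY ZZ B(1) hh B(2)] by metis
  moreover have "h \<bullet> mon_unit Q = mon_unit B"
    using comp_assoc[OF unit_ob A(1) Q(1) B(1) A(3) q(1) h(1)] q f' h by simp
  ultimately have "h \<in> Hom (Comm C) Q B" using h by (simp add: Comm_Hom_iff)
  then show ?thesis using that h by blast
qed


subsection \<open>Quotients by an ideal\<close>

text \<open>Unpacks the colimit over the \<open>option\<close>-indexed diagram: a cocone is a
  morphism \<open>f\<close> out of \<open>A\<close>, sitting at \<open>None\<close>, together with a
  factorization \<open>d t\<close> of it through each \<open>A/tA\<close>.\<close>

lemma is_ideal_quotientE: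
  assumes obA: "A \<in> Obj (Comm C)" and "is_ideal_quotient C A I R p"
  obtains Q q c where "\<And>t. t \<in> I \<Longrightarrow> is_element_quotient C A t (Q t) (q t)"
    and "R \<in> Obj (Comm C)" "p \<in> Hom (Comm C) A R"
    and "\<And>t. t \<in> I \<Longrightarrow> c t \<in> Hom (Comm C) (Q t) R \<and> c t \<bullet> q t = p"
    and "\<And>B f d. \<lbrakk>B \<in> Obj (Comm C); f \<in> Hom (Comm C) A B;
        \<And>t. t \<in> I \<Longrightarrow> d t \<in> Hom (Comm C) (Q t) B \<and> d t \<bullet> q t = f\<rbrakk>
      \<Longrightarrow> \<exists>!h. h \<in> Hom (Comm C) R B \<and> h \<bullet> p = f \<and> (\<forall>t\<in>I. h \<bullet> c t = d t)"
proof -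
  interpret Comm: category "Comm C" by (rule category_Comm)
  let ?J = "poset_cat (insert None (Some ` I)) (\<lambda>x y. x = None \<or> x = y)"
  obtain Q q c where quot: "\<And>t. t \<in> I \<Longrightarrow> is_element_quotient C A t (Q t) (q t)"
    and col: "is_colimit ?J (Comm C)
          (\<lambda>x. case x of None \<Rightarrow> A | Some t \<Rightarrow> Q t)
          (\<lambda>u. case u of (None, Some t) \<Rightarrow> q t
               | (None, None) \<Rightarrow> Idm (Comm C) A
               | (Some t, _) \<Rightarrow> Idm (Comm C) (Q t))
          R c" (is "is_colimit _ _ ?Fo ?Fm _ _")
    and p: "p = c None"
    using assms(2) unfolding is_ideal_quotient_def by blast
  show thesis
  proof (rule that[of Q q "\<lambda>t. c (Some t)"])
    show "is_element_quotient C A t (Q t) (q t)" if "t \<in> I" for t using quot that .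
    have cocone: "is_cocone ?J (Comm C) ?Fo ?Fm R c" using col by (simp add: is_colimit_def)
    show "R \<in> Obj (Comm C)" "p \<in> Hom (Comm C) A R"
      using cocone p by (auto simp: is_cocone_def poset_cat_def)
    show "c (Some t) \<in> Hom (Comm C) (Q t) R \<and> c (Some t) \<bullet> q t = p" if "t \<in> I" for t
      using cocone p that by (force simp: is_cocone_def poset_cat_def Comm_Cmp)
    fix B f d
    assume B: "B \<in> Obj (Comm C)" and f: "f \<in> Hom (Comm C) A B"
      and d: "\<And>t. t \<in> I \<Longrightarrow> d t \<in> Hom (Comm C) (Q t) B \<and> d t \<bullet> q t = f"
    let ?e = "case_option f d"
    have obQ: "Q t \<in> Obj (Comm C)" if "t \<in> I" for t
      using quot[OF that] by (simp add: is_element_quotient_def)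
    have "f \<bullet> Idm (Comm C) A = f"
      using Comm.comp_id[OF obA B f] by (simp add: Comm_Cmp)
    moreover have "d t \<bullet> Idm (Comm C) (Q t) = d t" if "t \<in> I" for t
      using Comm.comp_id[OF obQ[OF that] B, of "d t"] d[OF that] by (simp add: Comm_Cmp)
    ultimately have "is_cocone ?J (Comm C) ?Fo ?Fm B ?e"
      using B f d by (auto simp: is_cocone_def poset_cat_def Comm_Cmp)
    then have "\<exists>!h. h \<in> Hom (Comm C) R B \<and> (\<forall>i\<in>Obj ?J. h \<bullet>\<^bsub>Comm C\<^esub> c i = ?e i)"
      using col by (simp add: is_colimit_def)
    then show "\<exists>!h. h \<in> Hom (Comm C) R B \<and> h \<bullet> p = f \<and> (\<forall>t\<in>I. h \<bullet> c (Some t) = d t)"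
      by (simp add: poset_cat_def Comm_Cmp p)
  qed
qed

lemma ideal_quotient_epi:
  assumes obA: "A \<in> Obj (Comm C)" and I: "I \<subseteq> carrier (End_ring C A)"
    and quot: "is_ideal_quotient C A I R p"
  shows "is_epi (Comm C) A R p"
proof -
  interpret Comm: category "Comm C" by (rule category_Comm)
  obtain Q q c where el: "\<And>t. t \<in> I \<Longrightarrow> is_element_quotient C A t (Q t) (q t)"
    and R: "R \<in> Obj (Comm C)" and p: "p \<in> Hom (Comm C) A R"
    and c: "\<And>t. t \<in> I \<Longrightarrow> c t \<in> Hom (Comm C) (Q t) R \<and> c t \<bullet> q t = p"
    and univ: "\<And>B f d. \<lbrakk>B \<in> Obj (Comm C); f \<in> Hom (Comm C) A B;
        \<And>t. t \<in> I \<Longrightarrow> d t \<in> Hom (Comm C) (Q t) B \<and> d t \<bullet> q t = f\<rbrakk>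
      \<Longrightarrow> \<exists>!h. h \<in> Hom (Comm C) R B \<and> h \<bullet> p = f \<and> (\<forall>t\<in>I. h \<bullet> c t = d t)"
    by (fact is_ideal_quotientE[OF obA quot])
  have "g = h" if B: "B \<in> Obj (Comm C)" and g: "g \<in> Hom (Comm C) R B"
    and h: "h \<in> Hom (Comm C) R B" and eq: "g \<bullet> p = h \<bullet> p" for B g h
  proof -
    have leg: "x \<bullet> c t \<in> Hom (Comm C) (Q t) B" "(x \<bullet> c t) \<bullet> q t = x \<bullet> p"
      if "t \<in> I" "x \<in> Hom (Comm C) R B" for t x
    proof -
      have Q: "Q t \<in> Obj (Comm C)" "q t \<in> Hom (Comm C) A (Q t)"
        using el[OF that(1)] by (auto simp: is_element_quotient_def)
      have ct: "c t \<in> Hom (Comm C) (Q t) R" "c t \<bullet> q t = p" using c[OF that(1)] by auto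
      show "x \<bullet> c t \<in> Hom (Comm C) (Q t) B"
        using Comm.comp_in[OF Q(1) R B ct(1) that(2)] by (simp add: Comm_Cmp)
      show "(x \<bullet> c t) \<bullet> q t = x \<bullet> p"
        using Comm.comp_assoc[OF obA Q(1) R B Q(2) ct(1) that(2)] ct by (simp add: Comm_Cmp)
    qed
    have "g \<bullet> c t = h \<bullet> c t" if "t \<in> I" for t
    proof -
      have "is_epi (Comm C) A (Q t) (q t)"
        using element_quotient_epi[OF obA _ el[OF that]] I that by blast
      then have "inj_on (\<lambda>x. x \<bullet> q t) (Hom (Comm C) (Q t) B)"
        using B by (simp add: is_epi_def Comm_Cmp)
      then show ?thesis
        using leg[OF that g] leg[OF that h] eq by (simp add: inj_on_def)
    qed
    \<comment> \<open>\<open>h\<close> solves the extension problem with legs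
      \<open>g \<bullet> c t\<close>, which \<open>g\<close> solves trivially; uniqueness in the
      colimit then identifies them.\<close>
    then have h_ok: "h \<in> Hom (Comm C) R B \<and> h \<bullet> p = g \<bullet> p \<and> (\<forall>t\<in>I. h \<bullet> c t = g \<bullet> c t)"
      using h eq by simp
    have "g \<bullet> p \<in> Hom (Comm C) A B"
      using Comm.comp_in[OF obA R B p g] by (simp add: Comm_Cmp)
    then have ex1: "\<exists>!x. x \<in> Hom (Comm C) R B \<and> x \<bullet> p = g \<bullet> p \<and> (\<forall>t\<in>I. x \<bullet> c t = g \<bullet> c t)"
      by (rule univ[OF B]) (use leg g in simp)
    show "g = h" using ex1 h_ok g by (elim ex1E) metis
  qed
  then show ?thesis using p by (auto simp: is_epi_def inj_on_def Comm_Cmp)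
qed

text \<open>Every \<open>A \<rightarrow> A/xtA\<close> lies under \<open>A \<rightarrow> A/tA\<close>, and \<open>A/tA\<close> itself occurs in the diagram; both
  comparison maps are then mutually inverse because \<open>A \<rightarrow> A/tA\<close> and \<open>A \<rightarrow> A/(t)\<close> are epimorphisms.\<close>

lemma principal_quotient_iso:
  assumes obA: "A \<in> Obj (Comm C)" and t: "t \<in> carrier (End_ring C A)"
    and Q: "is_element_quotient C A t Q q"
    and quot: "is_ideal_quotient C A (PIdl\<^bsub>End_ring C A\<^esub> t) R p"
  shows "isomorphic (Comm C) Q R"
proof -
  interpret Comm: category "Comm C" by (rule category_Comm)
  let ?X = "mon_carrier A" and ?E = "carrier (End_ring C A)" and ?I = "PIdl\<^bsub>End_ring C A\<^esub> t"
  note A = comm_monoidD[OF obA] and XX = tensor_ob[OF comm_monoidD(1)[OF obA] comm_monoidD(1)[OF obA]]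
  have I: "?I = {x \<bullet> t | x. x \<in> ?E}"
    by (simp add: cgenideal_def End_ring_def Modules_def Let_def)
  have t': "t \<in> Hom C ?X ?X" using t by (simp add: End_ring_carrier_iff)
  have "Idm C ?X \<in> ?E"
    using id_in[OF A(1)] id_comp[OF XX A(1,2)] comp_id[OF XX A(1,2)] tensor_id[OF A(1) A(1)]
    by (simp add: End_ring_carrier_iff)
  then have tI: "t \<in> ?I" using id_comp[OF A(1) A(1) t'] unfolding I by force
  have I_sub: "?I \<subseteq> ?E"
  proof
    fix s assume "s \<in> ?I"
    then obtain x where x: "x \<in> ?E" "s = x \<bullet> t" unfolding I by blast
    then have x': "x \<in> Hom C ?X ?X" by (simp add: End_ring_carrier_iff)
    have arrs: "Idm C ?X \<boxdot> y \<in> Hom C (?X \<boxtimes> ?X) (?X \<boxtimes> ?X)" if "y \<in> Hom C ?X ?X" for y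
      using tensor_arr[OF A(1) A(1) A(1) A(1) id_in[OF A(1)] that] .
    have "(x \<bullet> t) \<bullet> mon_mult A = mon_mult A \<bullet> (Idm C ?X \<boxdot> (x \<bullet> t))"
      using comp_assoc[OF XX A(1) A(1) A(1) A(2) t' x']
        comp_assoc[OF XX XX A(1) A(1) arrs[OF t'] A(2) x']
        comp_assoc[OF XX XX XX A(1) arrs[OF t'] arrs[OF x'] A(2)]
        tensor_comp[OF A(1) A(1) A(1) A(1) A(1) A(1) id_in[OF A(1)] id_in[OF A(1)] t' x']
        comp_id[OF A(1) A(1) id_in[OF A(1)]] x t by (simp add: End_ring_carrier_iff)
    then show "s \<in> ?E" using x comp_in[OF A(1) A(1) A(1) t' x'] by (simp add: End_ring_carrier_iff)
  qed
  obtain Q' q' c where el: "\<And>s. s \<in> ?I \<Longrightarrow> is_element_quotient C A s (Q' s) (q' s)"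
    and R: "R \<in> Obj (Comm C)" and p: "p \<in> Hom (Comm C) A R"
    and c: "\<And>s. s \<in> ?I \<Longrightarrow> c s \<in> Hom (Comm C) (Q' s) R \<and> c s \<bullet> q' s = p"
    and univ: "\<And>B f d. \<lbrakk>B \<in> Obj (Comm C); f \<in> Hom (Comm C) A B;
        \<And>s. s \<in> ?I \<Longrightarrow> d s \<in> Hom (Comm C) (Q' s) B \<and> d s \<bullet> q' s = f\<rbrakk>
      \<Longrightarrow> \<exists>!h. h \<in> Hom (Comm C) R B \<and> h \<bullet> p = f \<and> (\<forall>s\<in>?I. h \<bullet> c s = d s)"
    by (fact is_ideal_quotientE[OF obA quot])
  have obQ: "Q \<in> Obj (Comm C)" and q: "q \<in> Hom (Comm C) A Q"
    using Q by (auto simp: is_element_quotient_def)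
  note QC = comm_monoidD(1)[OF obQ] and RC = comm_monoidD(1)[OF R]
  have q': "q \<in> Hom C ?X (mon_carrier Q)" using q by (simp add: Comm_Hom_iff)
  have qt: "q \<bullet> t = hzero C ?X (mon_carrier Q)"
    using element_quotient_cokernel[OF obA t Q] by (simp add: is_cokernel_def)
  have "\<exists>d. d \<in> Hom (Comm C) (Q' s) Q \<and> d \<bullet> q' s = q" if s: "s \<in> ?I" for s
  proof -
    obtain x where x: "x \<in> ?E" "s = x \<bullet> t" using s unfolding I by blast
    then have x': "x \<in> Hom C ?X ?X" by (simp add: End_ring_carrier_iff)
    \<comment> \<open>Elements of the ideal have the form \<open>x \<bullet> t\<close>, with
      \<open>x\<close> standing between \<open>q\<close> and \<open>t\<close>. Commutativity of the
      endomorphism ring brings \<open>t\<close> next to \<open>q\<close>.\<close>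
    have "q \<bullet> s = (q \<bullet> t) \<bullet> x"
      using comp_assoc[OF A(1) A(1) A(1) QC x' t' q'] End_ring_commute[OF obA x(1) t] x by simp
    then have "q \<bullet> s = hzero C ?X (mon_carrier Q)"
      using qt zero_comp[OF A(1) A(1) QC x'] by simp
    then show ?thesis
      using element_quotient_factor[OF obA _ el[OF s] obQ q] I_sub s by blast
  qed
  then have "\<forall>s. \<exists>d. s \<in> ?I \<longrightarrow> d \<in> Hom (Comm C) (Q' s) Q \<and> d \<bullet> q' s = q" by simp
  then obtain d where "\<forall>s. s \<in> ?I \<longrightarrow> d s \<in> Hom (Comm C) (Q' s) Q \<and> d s \<bullet> q' s = q"
    by (rule choice[THEN exE])
  then have "\<exists>!h. h \<in> Hom (Comm C) R Q \<and> h \<bullet> p = q \<and> (\<forall>s\<in>?I. h \<bullet> c s = d s)"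
    by (intro univ[OF obQ q]) simp
  then obtain h where h: "h \<in> Hom (Comm C) R Q" "h \<bullet> p = q"
    by (elim ex1E conjE)
  \<comment> \<open>The diagram's own representative \<open>Q' t\<close> may differ from
    \<open>Q\<close>, so \<open>c t\<close> does not start at \<open>Q\<close>. Instead,
    \<open>p\<close> kills \<open>t\<close> because it factors through \<open>q' t\<close>, and the
    universal property of \<open>Q\<close> then supplies \<open>k\<close>.\<close>
  have "p \<bullet> t = hzero C ?X (mon_carrier R)"
  proof -
    have ct: "c t \<in> Hom C (mon_carrier (Q' t)) (mon_carrier R)" "c t \<bullet> q' t = p"
      using c[OF tI] by (auto simp: Comm_Hom_iff)
    have obQ': "mon_carrier (Q' t) \<in> Obj C" and q't: "q' t \<in> Hom C ?X (mon_carrier (Q' t))"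
      "q' t \<bullet> t = hzero C ?X (mon_carrier (Q' t))"
      using element_quotient_cokernel[OF obA t el[OF tI]] by (auto simp: is_cokernel_def)
    show ?thesis
      using comp_assoc[OF A(1) A(1) obQ' RC t' q't(1) ct(1)] ct q't comp_zero[OF A(1) obQ' RC ct(1)]
      by simp
  qed
  then obtain k where k: "k \<in> Hom (Comm C) Q R" "k \<bullet> q = p"
    using element_quotient_factor[OF obA t Q R p] by blast
  have hk: "h \<bullet> k \<in> Hom (Comm C) Q Q" "(h \<bullet> k) \<bullet> q = q"
    using Comm.comp_in[OF obQ R obQ k(1) h(1)] Comm.comp_assoc[OF obA obQ R obQ q k(1) h(1)] h k
    by (simp_all add: Comm_Cmp)
  have kh: "k \<bullet> h \<in> Hom (Comm C) R R" "(k \<bullet> h) \<bullet> p = p"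
    using Comm.comp_in[OF R obQ R h(1) k(1)] Comm.comp_assoc[OF obA R obQ R p h(1) k(1)] h k
    by (simp_all add: Comm_Cmp)
  \<comment> \<open>Both round trips agree with the identity after composition with an epimorphism
    out of \<open>A\<close>.\<close>
  have "inj_on (\<lambda>x. x \<bullet> q) (Hom (Comm C) Q Q)" "inj_on (\<lambda>x. x \<bullet> p) (Hom (Comm C) R R)"
    using element_quotient_epi[OF obA t Q] ideal_quotient_epi[OF obA I_sub quot] obQ R
    by (simp_all add: is_epi_def Comm_Cmp)
  then have "h \<bullet> k = Idm (Comm C) Q" "k \<bullet> h = Idm (Comm C) R"
    using hk kh Comm.id_in[OF obQ] Comm.id_in[OF R] Comm.id_comp[OF obA obQ q]
      Comm.id_comp[OF obA R p] by (auto simp: inj_on_def Comm_Cmp)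
  then show ?thesis
    using h k unfolding isomorphic_def is_isomorphism_def Comm_Cmp by blast
qed

end

theorem proposition3p9:
  fixes C :: "('o, 'm) monoidal_ab_cat" and A :: "('o, 'm) mon_ob"
  assumes "standing_assumptions C TYPE('u)"
    and "A \<in> Obj (Comm C)"
  shows "(\<forall>t Q q R p. t \<in> carrier (End_ring C A) \<and> is_element_quotient C A t Q q \<and>
            is_ideal_quotient C A (PIdl\<^bsub>End_ring C A\<^esub> t) R p
            \<longrightarrow> isomorphic (Comm C) Q R)
       \<and> (\<forall>I R p. ideal I (End_ring C A) \<and> is_ideal_quotient C A I R p
            \<longrightarrow> is_epi (Comm C) A R p)"
proof -
  interpret standing_assumptions C "TYPE('u)" by (rule assms(1))
  show ?thesis
  proof (intro conjI allI impI; elim conjE)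
    fix t Q q R p
    assume "t \<in> carrier (End_ring C A)" "is_element_quotient C A t Q q"
      "is_ideal_quotient C A (PIdl\<^bsub>End_ring C A\<^esub> t) R p"
    then show "isomorphic (Comm C) Q R" by (rule principal_quotient_iso[OF assms(2)])
  next
    fix I R p
    assume "ideal I (End_ring C A)" and quot: "is_ideal_quotient C A I R p"
    then have "I \<subseteq> carrier (End_ring C A)" by (auto dest: ideal.Icarr)
    then show "is_epi (Comm C) A R p" using quot by (rule ideal_quotient_epi[OF assms(2)])
  qed
qed

end
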